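(* Let $S_\infty\subset\partial_\infty\mathbb{H}^2\times\mathbb{R}$ be a closed set strictly contained in a slab with width equal to $\pi$, i.e. $S_\infty\subset\partial_\infty\mathbb{H}^2\times(t_1,t_2)$ with $t_2-t_1=\pi$. Assume that the vertical projection of $S_\infty$ on $\partial_\infty\mathbb{H}^2\times\{0\}$ omits an open arc. Then there is no complete properly immersed minimal surface $M$ in $\mathbb{H}^2\times\mathbb{R}$ with asymptotic boundary $S_\infty$.
   Context: $\mathbb{H}^2$ is the hyperbolic plane (curvature $-1$), $\mathbb{H}^2\times\mathbb{R}$ has the product metric. In the Poincaré disk model, $\overline{\mathbb{H}^2}=\mathbb{H}^2\cup\partial_\infty\mathbb{H}^2$ is the closed unit disk with its Euclidean topology. The asymptotic boundary of a surface $M\subset\mathbb{H}^2\times\mathbb{R}$ is the set of points of $\partial_\infty\mathbb{H}^2\times\mathbb{R}$ that are limits, in $\overline{\mathbb{H}^2}\times\mathbb{R}$, of sequences of points of $M$. The vertical projection is $(q,t)\mapsto(q,0)$. *)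

theory Defs
  imports "HOL-Analysis.Analysis"
begin

section \<open>Smooth maps between open subsets of Euclidean spaces\<close>

text \<open>Meant for open sets \<open>U\<close>; all derivatives are two-sided.\<close>

primrec C_k_on :: "nat \<Rightarrow> ('a::euclidean_space \<Rightarrow> 'b::euclidean_space) \<Rightarrow> 'a set \<Rightarrow> bool" where
  "C_k_on 0 f U \<longleftrightarrow> continuous_on U f"
| "C_k_on (Suc k) f U \<longleftrightarrow>
     (\<forall>x\<in>U. f differentiable (at x)) \<and>
     (\<forall>v. C_k_on k (\<lambda>x. frechet_derivative f (at x) v) U)"

definition smooth_on :: "('a::euclidean_space \<Rightarrow> 'b::euclidean_space) \<Rightarrow> 'a set \<Rightarrow> bool" where
  "smooth_on f U \<longleftrightarrow> (\<forall>k. C_k_on k f U)"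

section \<open>Riemannian metrics in global coordinates\<close>

text \<open>
  A Riemannian metric on an open subset of a Euclidean space \<open>'e\<close> is a function \<open>g\<close>, where
  \<open>g x v w\<close> is the inner product of the tangent vectors \<open>v\<close> and \<open>w\<close> at \<open>x\<close>.
  The vector \<open>christoffel g x v w\<close> has the components
  \<open>\<Gamma>\<^sup>k\<^sub>i\<^sub>j v\<^sup>i w\<^sup>j\<close> of the Levi-Civita connection; it is determined by Koszul's
  formula for the constant vector fields \<open>v\<close>, \<open>w\<close>, \<open>u\<close>.
\<close>

type_synonym 'e riem = "'e \<Rightarrow> 'e \<Rightarrow> 'e \<Rightarrow> real"

definition christoffel :: "'e::euclidean_space riem \<Rightarrow> 'e \<Rightarrow> 'e \<Rightarrow> 'e \<Rightarrow> 'e" where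
  "christoffel g x v w = (THE c. \<forall>u. 2 * g x c u =
      frechet_derivative (\<lambda>y. g y w u) (at x) v
    + frechet_derivative (\<lambda>y. g y v u) (at x) w
    - frechet_derivative (\<lambda>y. g y v w) (at x) u)"

subsection \<open>Mean curvature of a parametrized surface\<close>

definition coord_deriv :: "2 \<Rightarrow> (real^2 \<Rightarrow> 'e::euclidean_space) \<Rightarrow> real^2 \<Rightarrow> 'e" where
  "coord_deriv i X u = frechet_derivative X (at u) (axis i 1)"

definition first_form :: "'e::euclidean_space riem \<Rightarrow> (real^2 \<Rightarrow> 'e) \<Rightarrow> real^2 \<Rightarrow> real^2^2" where
  "first_form g X u = (\<chi> i j. g (X u) (coord_deriv i X u) (coord_deriv j X u))"

text \<open>The ambient covariant derivative of \<open>\<partial>\<^sub>j X\<close> in direction \<open>\<partial>\<^sub>i X\<close>.\<close>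

definition cov_deriv ::
  "'e::euclidean_space riem \<Rightarrow> (real^2 \<Rightarrow> 'e) \<Rightarrow> real^2 \<Rightarrow> 2 \<Rightarrow> 2 \<Rightarrow> 'e" where
  "cov_deriv g X u i j = coord_deriv i (coord_deriv j X) u
     + christoffel g (X u) (coord_deriv i X u) (coord_deriv j X u)"

definition normal_part ::
  "'e::euclidean_space riem \<Rightarrow> (real^2 \<Rightarrow> 'e) \<Rightarrow> real^2 \<Rightarrow> 'e \<Rightarrow> 'e" where
  "normal_part g X u v = v - (\<Sum>i\<in>UNIV. \<Sum>j\<in>UNIV.
     (matrix_inv (first_form g X u) $ i $ j * g (X u) v (coord_deriv i X u)) *\<^sub>R coord_deriv j X u)"

text \<open>Half the trace of the vector-valued second fundamental form.\<close>

definition mean_curvature_vector ::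
  "'e::euclidean_space riem \<Rightarrow> (real^2 \<Rightarrow> 'e) \<Rightarrow> real^2 \<Rightarrow> 'e" where
  "mean_curvature_vector g X u = (1/2) *\<^sub>R (\<Sum>i\<in>UNIV. \<Sum>j\<in>UNIV.
     (matrix_inv (first_form g X u) $ i $ j) *\<^sub>R normal_part g X u (cov_deriv g X u i j))"

section \<open>Smooth surfaces\<close>

text \<open>An atlas is a set of pairs \<open>(U, \<phi>)\<close>; the values of \<open>\<phi>\<close> outside \<open>U\<close> are irrelevant.\<close>

type_synonym 'a atlas = "('a set \<times> ('a \<Rightarrow> real^2)) set"

text \<open>Surfaces are nonempty and without boundary, but not required to be connected.\<close>

definition smooth_surface :: "'a topology \<Rightarrow> 'a atlas \<Rightarrow> bool" where
  "smooth_surface M \<A> \<longleftrightarrow>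
     topspace M \<noteq> {} \<and> Hausdorff_space M \<and> second_countable M \<and>
     (\<forall>(U, \<phi>)\<in>\<A>. openin M U \<and> open (\<phi> ` U) \<and>
        homeomorphic_map (subtopology M U) (top_of_set (\<phi> ` U)) \<phi>) \<and>
     topspace M = \<Union> (fst ` \<A>) \<and>
     (\<forall>(U, \<phi>)\<in>\<A>. \<forall>(V, \<psi>)\<in>\<A>. smooth_on (\<psi> \<circ> inv_into U \<phi>) (\<phi> ` (U \<inter> V)))"

definition immersed_surface ::
  "'e::euclidean_space set \<Rightarrow> 'a topology \<Rightarrow> 'a atlas \<Rightarrow> ('a \<Rightarrow> 'e) \<Rightarrow> bool" where
  "immersed_surface N M \<A> F \<longleftrightarrow>
     smooth_surface M \<A> \<and> F ` topspace M \<subseteq> N \<and>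
     (\<forall>(U, \<phi>)\<in>\<A>. smooth_on (F \<circ> inv_into U \<phi>) (\<phi> ` U) \<and>
        (\<forall>u\<in>\<phi> ` U. inj (frechet_derivative (F \<circ> inv_into U \<phi>) (at u))))"

definition minimal_immersion ::
  "'e::euclidean_space riem \<Rightarrow> 'a atlas \<Rightarrow> ('a \<Rightarrow> 'e) \<Rightarrow> bool" where
  "minimal_immersion g \<A> F \<longleftrightarrow>
     (\<forall>(U, \<phi>)\<in>\<A>. \<forall>u\<in>\<phi> ` U. mean_curvature_vector g (F \<circ> inv_into U \<phi>) u = 0)"

definition properly_immersed :: "'e::euclidean_space set \<Rightarrow> 'a topology \<Rightarrow> ('a \<Rightarrow> 'e) \<Rightarrow> bool" where
  "properly_immersed N M F \<longleftrightarrow> proper_map M (top_of_set N) F"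

subsection \<open>Completeness of the induced metric\<close>

definition piecewise_C1_curve :: "'a topology \<Rightarrow> 'a atlas \<Rightarrow> (real \<Rightarrow> 'a) \<Rightarrow> bool" where
  "piecewise_C1_curve M \<A> c \<longleftrightarrow> pathin M c \<and>
     (\<forall>(U, \<phi>)\<in>\<A>. \<forall>a b. 0 \<le> a \<longrightarrow> a < b \<longrightarrow> b \<le> 1 \<longrightarrow> c ` {a..b} \<subseteq> U \<longrightarrow>
        (\<phi> \<circ> c) piecewise_C1_differentiable_on {a..b})"

text \<open>
  The length of \<open>c\<close> in the pulled-back metric \<open>F\<^sup>* g\<close>. The library's piecewise \<open>C\<^sup>1\<close> curves
  may have unbounded speed near a break point, and so infinite length; hence the
  \<open>ennreal\<close>-valued integral.
\<close>

definition curve_length ::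
  "'e::euclidean_space riem \<Rightarrow> ('a \<Rightarrow> 'e) \<Rightarrow> (real \<Rightarrow> 'a) \<Rightarrow> ennreal" where
  "curve_length g F c = (\<integral>\<^sup>+s\<in>{0..1}. ennreal (sqrt (g (F (c s))
     (vector_derivative (F \<circ> c) (at s)) (vector_derivative (F \<circ> c) (at s)))) \<partial>lborel)"

text \<open>The distance of points in different components is \<open>\<infinity>\<close>.\<close>

definition intrinsic_dist ::
  "'e::euclidean_space riem \<Rightarrow> 'a topology \<Rightarrow> 'a atlas \<Rightarrow> ('a \<Rightarrow> 'e) \<Rightarrow> 'a \<Rightarrow> 'a \<Rightarrow> ennreal" where
  "intrinsic_dist g M \<A> F p q =
     (INF c\<in>{c. piecewise_C1_curve M \<A> c \<and> c 0 = p \<and> c 1 = q}. curve_length g F c)"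

definition complete_surface ::
  "'e::euclidean_space riem \<Rightarrow> 'a topology \<Rightarrow> 'a atlas \<Rightarrow> ('a \<Rightarrow> 'e) \<Rightarrow> bool" where
  "complete_surface g M \<A> F \<longleftrightarrow>
     (\<forall>\<sigma>. range \<sigma> \<subseteq> topspace M \<longrightarrow>
        (\<forall>e>0. \<exists>N::nat. \<forall>m\<ge>N. \<forall>n\<ge>N. intrinsic_dist g M \<A> F (\<sigma> m) (\<sigma> n) < e) \<longrightarrow>
        (\<exists>p\<in>topspace M. (\<lambda>n. intrinsic_dist g M \<A> F (\<sigma> n) p) \<longlonglongrightarrow> 0))"

section \<open>The product of the hyperbolic plane with the line\<close>

text \<open>Poincare disk model, curvature \<open>-1\<close>: the metric is \<open>4 |dz|\<^sup>2 / (1 - |z|\<^sup>2)\<^sup>2 + dt\<^sup>2\<close>.\<close>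

definition H2 :: "complex set" where
  "H2 = ball 0 1"

definition bdry_H2 :: "complex set" where
  "bdry_H2 = sphere 0 1"

definition H2xR :: "(complex \<times> real) set" where
  "H2xR = H2 \<times> UNIV"

definition H2xR_metric :: "(complex \<times> real) riem" where
  "H2xR_metric x v w =
     4 / (1 - (norm (fst x))\<^sup>2)\<^sup>2 * (fst v \<bullet> fst w) + snd v * snd w"

text \<open>The description in \<open>christoffel\<close> is a genuine one for this metric.\<close>

lemma has_derivative_H2xR_metric:
  assumes "x \<in> H2xR"
  shows "((\<lambda>y. H2xR_metric y v w) has_derivative
    (\<lambda>u. 16 * (fst x \<bullet> fst u) / (1 - (norm (fst x))\<^sup>2) ^ 3 * (fst v \<bullet> fst w))) (at x)"
proof -
  have nz: "1 - fst x \<bullet> fst x \<noteq> 0"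
  proof -
    have "norm (fst x) < 1"
      using assms by (auto simp: H2xR_def H2_def)
    then have "(norm (fst x))\<^sup>2 < 1"
      by (simp add: power_less_one_iff)
    then show ?thesis by (simp add: power2_norm_eq_inner)
  qed
  have "((\<lambda>y. 1 - fst y \<bullet> fst y) has_derivative (\<lambda>u. - 2 * (fst x \<bullet> fst u))) (at x)"
    by (auto intro!: derivative_eq_intros simp: inner_commute)
  then have "((\<lambda>y. (1 - fst y \<bullet> fst y)\<^sup>2) has_derivative
      (\<lambda>u. - 4 * (1 - fst x \<bullet> fst x) * (fst x \<bullet> fst u))) (at x)"
    by (rule derivative_eq_intros) (simp add: algebra_simps)
  then have "((\<lambda>y. inverse ((1 - fst y \<bullet> fst y)\<^sup>2)) has_derivative
      (\<lambda>u. - (inverse ((1 - fst x \<bullet> fst x)\<^sup>2) *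
        (- 4 * (1 - fst x \<bullet> fst x) * (fst x \<bullet> fst u)) * inverse ((1 - fst x \<bullet> fst x)\<^sup>2)))) (at x)"
    by (rule Deriv.has_derivative_inverse[rotated]) (use nz in simp)
  then have "((\<lambda>y. inverse ((1 - fst y \<bullet> fst y)\<^sup>2) * (4 * (fst v \<bullet> fst w)) + snd v * snd w)
      has_derivative (\<lambda>u. - (inverse ((1 - fst x \<bullet> fst x)\<^sup>2) *
        (- 4 * (1 - fst x \<bullet> fst x) * (fst x \<bullet> fst u)) * inverse ((1 - fst x \<bullet> fst x)\<^sup>2))
          * (4 * (fst v \<bullet> fst w)))) (at x)"
    by (intro has_derivative_add_const has_derivative_mult_left)
  moreover have "(\<lambda>y. inverse ((1 - fst y \<bullet> fst y)\<^sup>2) * (4 * (fst v \<bullet> fst w)) + snd v * snd w)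
      = (\<lambda>y. H2xR_metric y v w)"
    by (simp add: fun_eq_iff H2xR_metric_def power2_norm_eq_inner divide_inverse)
  moreover have alg: "- (inverse (d\<^sup>2) * (- 4 * d * r) * inverse (d\<^sup>2)) * (4 * s) = 16 * r / d ^ 3 * s"
    if "d \<noteq> 0" for d r s :: real
    using that by (simp add: divide_simps power2_eq_square power3_eq_cube)
  ultimately show ?thesis
    by (simp only: alg[OF nz] power2_norm_eq_inner)
qed

lemma christoffel_H2xR:
  assumes "x \<in> H2xR"
  shows "christoffel H2xR_metric x v w =
    ((2 / (1 - (norm (fst x))\<^sup>2)) *\<^sub>R
       ((fst x \<bullet> fst v) *\<^sub>R fst w + (fst x \<bullet> fst w) *\<^sub>R fst v - (fst v \<bullet> fst w) *\<^sub>R fst x), 0)"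
    (is "_ = ?c")
proof -
  define d where "d = 1 - (norm (fst x))\<^sup>2"
  have d: "d > 0"
    using assms by (auto simp: H2xR_def H2_def d_def power_less_one_iff)
  have D: "frechet_derivative (\<lambda>y. H2xR_metric y a b) (at x) u
      = 16 * (fst x \<bullet> fst u) / d ^ 3 * (fst a \<bullet> fst b)" for a b u
    using frechet_derivative_at[OF has_derivative_H2xR_metric[OF assms]] unfolding d_def by metis
  have c: "2 * H2xR_metric x ?c u =
      frechet_derivative (\<lambda>y. H2xR_metric y w u) (at x) v
    + frechet_derivative (\<lambda>y. H2xR_metric y v u) (at x) w
    - frechet_derivative (\<lambda>y. H2xR_metric y v w) (at x) u" for u
  proof -
    have alg: "2 * (4 / d\<^sup>2 * (2 / d * (p * q + r * s - m * n))) =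
        16 * p / d ^ 3 * q + 16 * r / d ^ 3 * s - 16 * n / d ^ 3 * m" for p q r s m n
    proof -
      have "2 * (4 / d\<^sup>2 * (2 / d * (p * q + r * s - m * n))) = 16 / d ^ 3 * (p * q + r * s - m * n)"
        by (simp add: power2_eq_square power3_eq_cube)
      then show ?thesis by (simp only: right_diff_distrib distrib_left times_divide_eq_left)
        (simp add: add_divide_distrib diff_divide_distrib mult_ac)
    qed
    show ?thesis
      unfolding D unfolding H2xR_metric_def d_def[symmetric]
      by (simp only: fst_conv snd_conv inner_scaleR_left inner_add_left inner_diff_left alg mult_zero_left add_0_right)
  qed
  have uniq: "a = b" if "\<And>u. H2xR_metric x a u = H2xR_metric x b u" for a b
  proof -
    have "4 / d\<^sup>2 * ((fst a - fst b) \<bullet> (fst a - fst b)) + (snd a - snd b) * (snd a - snd b) = 0"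
      using that[of "a - b"] unfolding H2xR_metric_def d_def[symmetric]
      by (simp add: inner_diff_left algebra_simps)
    moreover have "4 / d\<^sup>2 * ((fst a - fst b) \<bullet> (fst a - fst b)) \<ge> 0"
      "(snd a - snd b) * (snd a - snd b) \<ge> 0"
      using d by auto
    ultimately have "4 / d\<^sup>2 * ((fst a - fst b) \<bullet> (fst a - fst b)) = 0"
      "(snd a - snd b) * (snd a - snd b) = 0"
      by linarith+
    then show ?thesis using d by (auto simp: prod_eq_iff)
  qed
  show ?thesis
    unfolding christoffel_def
  proof (rule the_equality)
    show "\<forall>u. 2 * H2xR_metric x ?c u =
        frechet_derivative (\<lambda>y. H2xR_metric y w u) (at x) v
      + frechet_derivative (\<lambda>y. H2xR_metric y v u) (at x) w
      - frechet_derivative (\<lambda>y. H2xR_metric y v w) (at x) u"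
      using c by blast
  next
    fix c'
    assume c': "\<forall>u. 2 * H2xR_metric x c' u =
        frechet_derivative (\<lambda>y. H2xR_metric y w u) (at x) v
      + frechet_derivative (\<lambda>y. H2xR_metric y v u) (at x) w
      - frechet_derivative (\<lambda>y. H2xR_metric y v w) (at x) u"
    have "2 * H2xR_metric x c' u = 2 * H2xR_metric x ?c u" for u
      unfolding c[of u] using c' by blast
    then show "c' = ?c"
      by (intro uniq) simp
  qed
qed

section \<open>Asymptotic boundary, arcs and vertical projection\<close>

text \<open>Here \<open>\<Sigma>\<close> is the image of an immersed surface; limits are Euclidean.\<close>

definition asymptotic_boundary :: "(complex \<times> real) set \<Rightarrow> (complex \<times> real) set" where
  "asymptotic_boundary \<Sigma> =
     {p \<in> bdry_H2 \<times> UNIV. \<exists>\<sigma> :: nat \<Rightarrow> complex \<times> real. range \<sigma> \<subseteq> \<Sigma> \<and> \<sigma> \<longlonglongrightarrow> p}"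

definition open_arc :: "complex set \<Rightarrow> bool" where
  "open_arc J \<longleftrightarrow> (\<exists>a b. a < b \<and> b < a + 2 * pi \<and> J = cis ` {a<..<b})"

definition vertical_projection :: "complex \<times> real \<Rightarrow> complex \<times> real" where
  "vertical_projection = (\<lambda>(q, t). (q, 0))"

definition complete_properly_immersed_minimal_surface ::
  "'a topology \<Rightarrow> 'a atlas \<Rightarrow> ('a \<Rightarrow> complex \<times> real) \<Rightarrow> bool" where
  "complete_properly_immersed_minimal_surface M \<A> F \<longleftrightarrow>
     immersed_surface H2xR M \<A> F \<and> minimal_immersion H2xR_metric \<A> F \<and>
     properly_immersed H2xR M F \<and> complete_surface H2xR_metric M \<A> F"

end

theory Submission
  imports Defs
begin

text \<open>
  The proof uses the maximum principle for two explicit functions of the form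
  \<open>f = h (z) * cos (l (t - T))\<close> on \<open>H2xR\<close>, where \<open>h\<close> is the restriction of a linear form to the
  hyperboloid. Such an \<open>h\<close> satisfies \<open>Hess h = h g\<close> and \<open>|\<nabla>h|\<^sup>2 = h\<^sup>2 - \<kappa>\<close> with
  a constant \<open>\<kappa>\<close>. At an extremum of \<open>f\<close> on a minimal surface, the tangent plane is tangent to the
  level set of \<open>f\<close>, and the Laplacian of \<open>f\<close> on the surface is the trace of \<open>Hess f\<close> on
  that plane, since the mean curvature vanishes (\<open>barrier_extremum_at_minimal_point\<close>). Where the
  cosine \<open>c\<close> is positive and the gradient of \<open>f\<close> is not zero, this trace is a positive multiple of
  \<open>(1 - l\<^sup>2) c\<^sup>2 |\<nabla>h|\<^sup>2 + 2 l\<^sup>2 s\<^sup>2 \<kappa>\<close>, with \<open>s\<close> the sine (\<open>barrier_trace\<close>).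

  For \<open>h = cosh \<rho>\<close>, with \<open>\<rho>\<close> the distance to the centre of the disk, one has \<open>\<kappa> = 1\<close>, and with
  \<open>0 < l < 1\<close> the trace is positive, also where the gradient vanishes: \<open>f\<close> has no maximum on a minimal
  surface where the cosine is positive. As \<open>f\<close> vanishes on the boundary of a slab of width
  \<open>\<pi> / l\<close>, a surface without asymptotic boundary in the closed slab cannot enter the open slab. Hence
  a surface whose asymptotic boundary lies in a slab lies in that slab itself (\<open>slab_confinement\<close>).

  For the form \<open>h\<close> of the horocycles at an ideal point \<open>q\<close> one has \<open>\<kappa> = 0\<close>, and with \<open>l > 1\<close> the trace is
  negative: \<open>f\<close> has no minimum on a minimal surface where the cosine is positive. Take \<open>q\<close> in the omitted
  arc. The set \<open>S\<close> is compact, so it lies in a slab of width less than \<open>\<pi>\<close>, as does the surface,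
  and the cosine is positive on that slab for some \<open>l > 1\<close>. As \<open>h\<close> tends to infinity at every
  ideal point other than \<open>q\<close>, the function \<open>f\<close> attains its minimum on the surface, a contradiction
  (\<open>no_minimal_surface_avoiding_ideal_point\<close>).
\<close>

section \<open>Linear forms on the hyperboloid\<close>

text \<open>
  On the hyperboloid model, with \<open>x\<^sub>0 = (1 + |z|\<^sup>2) / (1 - |z|\<^sup>2)\<close> and
  \<open>x = 2z / (1 - |z|\<^sup>2)\<close>, this is the linear form \<open>x\<^sub>0 - \<beta> \<bullet> x\<close>. For \<open>\<beta> = 0\<close> it is
  the hyperbolic cosine of the distance to the centre of the disk; for an ideal point \<open>\<beta>\<close>
  its level sets are the horocycles at \<open>\<beta>\<close>, and in the half-plane with \<open>\<beta>\<close> at infinity it is \<open>1 / y\<close>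
  up to a factor.
\<close>

definition hyp_form :: "complex \<Rightarrow> complex \<Rightarrow> real" where
  "hyp_form \<beta> z = (1 + z \<bullet> z - 2 * (\<beta> \<bullet> z)) / (1 - z \<bullet> z)"

lemma H2_inner: "z \<in> H2 \<longleftrightarrow> z \<bullet> z < 1"
  by (simp add: H2_def norm_lt_square[of z 1, simplified] flip: power2_norm_eq_inner)

text \<open>
  The gradient of \<open>hyp_form \<beta>\<close>, expressed in the frame that is \<open>(1 - |z|\<^sup>2) / 2\<close> times
  the Euclidean one and so orthonormal for the hyperbolic metric.
\<close>

definition hyp_form_grad :: "complex \<Rightarrow> complex \<Rightarrow> complex" where
  "hyp_form_grad \<beta> z = (z - \<beta>) + hyp_form \<beta> z *\<^sub>R z"

text \<open>
  Linear forms on the hyperboloid satisfy \<open>|\<nabla>h|\<^sup>2 = h\<^sup>2 + \<langle>\<xi>, \<xi>\<rangle>\<close> for the Lorentzian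
  square \<open>\<langle>\<xi>, \<xi>\<rangle> = |\<beta>|\<^sup>2 - 1\<close> of their coefficient vector \<open>\<xi> = (1, \<beta>)\<close>.
\<close>

lemma norm_hyp_form_grad:
  assumes "z \<in> H2"
  shows "hyp_form_grad \<beta> z \<bullet> hyp_form_grad \<beta> z = (hyp_form \<beta> z)\<^sup>2 - (1 - \<beta> \<bullet> \<beta>)"
proof -
  define r b where "r = z \<bullet> z" and "b = \<beta> \<bullet> z"
  have w: "1 - r \<noteq> 0" using assms by (simp add: H2_inner r_def)
  define h where "h = hyp_form \<beta> z"
  have h: "h * (1 - r) = 1 + r - 2 * b"
    using w by (simp add: h_def hyp_form_def r_def b_def)
  have "hyp_form_grad \<beta> z \<bullet> hyp_form_grad \<beta> z = (r - 2 * b + \<beta> \<bullet> \<beta>) + 2 * h * (r - b) + h\<^sup>2 * r"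
    unfolding hyp_form_grad_def h_def[symmetric] r_def b_def
    by (simp add: inner_add_left inner_add_right inner_diff_left inner_diff_right inner_commute
        power2_eq_square algebra_simps)
  also have "\<dots> = h\<^sup>2 - (1 - \<beta> \<bullet> \<beta>)"
  proof -
    have "h\<^sup>2 * (1 - r) = h * (1 + r - 2 * b)" using h by (simp add: power2_eq_square)
    then show ?thesis using h by (simp add: algebra_simps)
  qed
  finally show ?thesis by (simp add: h_def)
qed

lemma hyp_form_0_ge_1: "z \<in> H2 \<Longrightarrow> hyp_form 0 z \<ge> 1"
  by (simp add: hyp_form_def H2_inner field_simps)

lemma hyp_form_ideal:
  assumes "\<beta> \<in> bdry_H2"
  shows "hyp_form \<beta> z = (norm (z - \<beta>))\<^sup>2 / (1 - z \<bullet> z)"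
proof -
  have "\<beta> \<bullet> \<beta> = 1" using assms by (simp add: bdry_H2_def norm_eq_1)
  then show ?thesis
    unfolding hyp_form_def power2_norm_eq_inner inner_diff_left inner_diff_right
    by (simp add: inner_commute[of z \<beta>])
qed

lemma hyp_form_ideal_pos:
  assumes "\<beta> \<in> bdry_H2" "z \<in> H2"
  shows "hyp_form \<beta> z > 0"
proof -
  have "z \<noteq> \<beta>" using assms by (auto simp: H2_def bdry_H2_def)
  then show ?thesis using assms(2) by (simp add: hyp_form_ideal[OF assms(1)] H2_inner)
qed

lemma hyp_form_deriv_along_curve:
  assumes z: "(z has_vector_derivative z1) (at s)" and H: "z s \<in> H2"
  shows "((\<lambda>s. hyp_form \<beta> (z s)) has_real_derivative
     2 / (1 - z s \<bullet> z s) * (hyp_form_grad \<beta> (z s) \<bullet> z1)) (at s)"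
proof -
  define i where "i = inverse (1 - z s \<bullet> z s)"
  have w: "1 - z s \<bullet> z s \<noteq> 0" using H by (simp add: H2_inner)
  have D: "((\<lambda>s. z s \<bullet> z s) has_real_derivative 2 * (z s \<bullet> z1)) (at s)"
    "((\<lambda>s. \<beta> \<bullet> z s) has_real_derivative \<beta> \<bullet> z1) (at s)"
    using z unfolding has_vector_derivative_def has_field_derivative_def
    by (auto intro!: derivative_eq_intros simp: inner_commute algebra_simps fun_eq_iff)
  have Di: "((\<lambda>s. inverse (1 - z s \<bullet> z s)) has_real_derivative 2 * i\<^sup>2 * (z s \<bullet> z1)) (at s)"
    by (rule derivative_eq_intros D refl w)+ (simp add: i_def power2_eq_square)
  have "((\<lambda>s. (1 + z s \<bullet> z s - 2 * (\<beta> \<bullet> z s)) * inverse (1 - z s \<bullet> z s)) has_real_derivative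
     (2 * (z s \<bullet> z1) - 2 * (\<beta> \<bullet> z1)) * i + (1 + z s \<bullet> z s - 2 * (\<beta> \<bullet> z s)) * (2 * i\<^sup>2 * (z s \<bullet> z1))) (at s)"
    by (rule derivative_eq_intros D Di refl)+ (simp add: i_def)
  moreover have "(2 * (z s \<bullet> z1) - 2 * (\<beta> \<bullet> z1)) * i + (1 + z s \<bullet> z s - 2 * (\<beta> \<bullet> z s)) * (2 * i\<^sup>2 * (z s \<bullet> z1))
    = 2 * i * (hyp_form_grad \<beta> (z s) \<bullet> z1)"
    unfolding hyp_form_grad_def hyp_form_def divide_inverse i_def[symmetric]
      inner_add_left inner_diff_left inner_scaleR_left
    by algebra
  ultimately show ?thesis
    unfolding hyp_form_def divide_inverse i_def by simp
qed

text \<open>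
  Linear forms on the hyperboloid satisfy \<open>Hess h = h g\<close>. The vector \<open>\<zeta>\<close> is the covariant
  acceleration of the curve, and the two summands are \<open>Hess h (z', z')\<close> and \<open>dh \<zeta>\<close>.
\<close>

lemma hyp_form_second_deriv_along_curve:
  assumes z: "(z has_vector_derivative z1 s) (at s)" and z1: "(z1 has_vector_derivative z2) (at s)"
    and H: "z s \<in> H2"
  defines "w \<equiv> 1 - z s \<bullet> z s"
  defines "\<zeta> \<equiv> z2 + (2 / w) *\<^sub>R ((2 * (z s \<bullet> z1 s)) *\<^sub>R z1 s - (z1 s \<bullet> z1 s) *\<^sub>R z s)"
  shows "((\<lambda>s. 2 / (1 - z s \<bullet> z s) * (hyp_form_grad \<beta> (z s) \<bullet> z1 s)) has_real_derivative
     hyp_form \<beta> (z s) * (4 / w\<^sup>2 * (z1 s \<bullet> z1 s)) + 2 / w * (hyp_form_grad \<beta> (z s) \<bullet> \<zeta>)) (at s)"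
proof -
  define i h where "i = inverse w" and "h = hyp_form \<beta> (z s)"
  have w: "1 - z s \<bullet> z s \<noteq> 0" using H by (simp add: H2_inner)
  have i: "i * (1 - z s \<bullet> z s) = 1" using w by (simp add: i_def w_def)
  have h: "h = (1 + z s \<bullet> z s - 2 * (\<beta> \<bullet> z s)) * i"
    by (simp add: h_def hyp_form_def i_def w_def divide_inverse)
  have D: "((\<lambda>s. z s \<bullet> z s) has_real_derivative 2 * (z s \<bullet> z1 s)) (at s)"
    "((\<lambda>s. z s \<bullet> z1 s) has_real_derivative z1 s \<bullet> z1 s + z s \<bullet> z2) (at s)"
    "((\<lambda>s. \<beta> \<bullet> z1 s) has_real_derivative \<beta> \<bullet> z2) (at s)"
    using z z1 unfolding has_vector_derivative_def has_field_derivative_def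
    by (auto intro!: derivative_eq_intros simp: inner_commute algebra_simps fun_eq_iff)
  \<comment> \<open>Writing \<open>i\<close> for the inverse of \<open>1 - |z|\<^sup>2\<close> makes all identities polynomial.\<close>
  have Di: "((\<lambda>s. inverse (1 - z s \<bullet> z s)) has_real_derivative 2 * i\<^sup>2 * (z s \<bullet> z1 s)) (at s)"
    by (rule derivative_eq_intros D refl w)+ (simp add: i_def w_def power2_eq_square)
  have Dh: "((\<lambda>s. hyp_form \<beta> (z s)) has_real_derivative 2 * i * (hyp_form_grad \<beta> (z s) \<bullet> z1 s)) (at s)"
    using hyp_form_deriv_along_curve[OF z H] by (simp add: i_def w_def divide_inverse)
  have "((\<lambda>s. 2 * inverse (1 - z s \<bullet> z s) * (z s \<bullet> z1 s - \<beta> \<bullet> z1 s + hyp_form \<beta> (z s) * (z s \<bullet> z1 s)))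
    has_real_derivative
      2 * (2 * i\<^sup>2 * (z s \<bullet> z1 s)) * (z s \<bullet> z1 s - \<beta> \<bullet> z1 s + h * (z s \<bullet> z1 s))
      + 2 * i * (z1 s \<bullet> z1 s + z s \<bullet> z2 - \<beta> \<bullet> z2
         + (2 * i * (hyp_form_grad \<beta> (z s) \<bullet> z1 s) * (z s \<bullet> z1 s) + h * (z1 s \<bullet> z1 s + z s \<bullet> z2)))) (at s)"
    by (rule derivative_eq_intros D Dh Di refl)+ (simp add: i_def w_def h_def)
  moreover have "2 * (2 * i\<^sup>2 * (z s \<bullet> z1 s)) * (z s \<bullet> z1 s - \<beta> \<bullet> z1 s + h * (z s \<bullet> z1 s))
      + 2 * i * (z1 s \<bullet> z1 s + z s \<bullet> z2 - \<beta> \<bullet> z2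
         + (2 * i * (hyp_form_grad \<beta> (z s) \<bullet> z1 s) * (z s \<bullet> z1 s) + h * (z1 s \<bullet> z1 s + z s \<bullet> z2)))
     = h * (4 * i\<^sup>2 * (z1 s \<bullet> z1 s)) + 2 * i * (hyp_form_grad \<beta> (z s) \<bullet> \<zeta>)"
  proof -
    have alg: "2 * (2 * i\<^sup>2 * p) * (p - q + h * p) + 2 * i * (V + d - e + (2 * i * (p - q + h * p) * p + h * (V + d)))
      = h * (4 * i\<^sup>2 * V) + 2 * i * (d - e + h * d + 2 * i * (2 * p * (p - q + h * p) - V * (r - b + h * r)))"
      if "i * (1 - r) = 1" "h = (1 + r - 2 * b) * i" for i p q h V d e r b :: real
      using that by algebra
    show ?thesis
      unfolding \<zeta>_def hyp_form_grad_def h_def[symmetric] divide_inverse i_def[symmetric]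
        inner_add_left inner_diff_left inner_scaleR_left inner_add_right inner_diff_right inner_scaleR_right
      by (rule alg[OF i h])
  qed
  ultimately show ?thesis
    unfolding hyp_form_grad_def h_def i_def w_def divide_inverse power_inverse inner_add_left inner_diff_left inner_scaleR_left
    by simp
qed

section \<open>The barrier and its Hessian\<close>

text \<open>
  With the half-plane coordinate \<open>y\<close> for an ideal point \<open>\<beta>\<close> at infinity, the level sets for
  \<open>l = 1\<close> are the surfaces \<open>y = const * cos (t - T)\<close>, which are minimal and have height \<open>\<pi>\<close>. The
  parameter \<open>l\<close> changes the height to \<open>\<pi> / l\<close>; this gives the level sets a strict sign of mean
  curvature, which replaces a strong maximum principle.
\<close>

definition barrier :: "complex \<Rightarrow> real \<Rightarrow> real \<Rightarrow> complex \<times> real \<Rightarrow> real" where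
  "barrier \<beta> l T p = hyp_form \<beta> (fst p) * cos (l * (snd p - T))"

definition barrier_deriv :: "complex \<Rightarrow> real \<Rightarrow> real \<Rightarrow> complex \<times> real \<Rightarrow> complex \<times> real \<Rightarrow> real" where
  "barrier_deriv \<beta> l T p v =
     2 / (1 - fst p \<bullet> fst p) * (hyp_form_grad \<beta> (fst p) \<bullet> fst v) * cos (l * (snd p - T))
     - l * hyp_form \<beta> (fst p) * sin (l * (snd p - T)) * snd v"

text \<open>
  The Riemannian Hessian, by \<open>barrier_second_deriv_along_curve\<close>. In the first summand the equation
  \<open>Hess h = h g\<close> on the hyperbolic plane has been used.
\<close>

definition barrier_hess :: "complex \<Rightarrow> real \<Rightarrow> real \<Rightarrow> complex \<times> real \<Rightarrow> complex \<times> real \<Rightarrow> real" where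
  "barrier_hess \<beta> l T p v =
     hyp_form \<beta> (fst p) * cos (l * (snd p - T)) * (4 / (1 - fst p \<bullet> fst p)\<^sup>2 * (fst v \<bullet> fst v))
     - 2 * l * sin (l * (snd p - T)) * (2 / (1 - fst p \<bullet> fst p) * (hyp_form_grad \<beta> (fst p) \<bullet> fst v)) * snd v
     - l\<^sup>2 * hyp_form \<beta> (fst p) * cos (l * (snd p - T)) * (snd v)\<^sup>2"

lemma linear_barrier_deriv: "linear (barrier_deriv \<beta> l T p)"
  by (rule linearI) (simp_all add: barrier_deriv_def inner_add_right algebra_simps)

lemma continuous_on_barrier: "continuous_on H2xR (barrier \<beta> l T)"
  unfolding barrier_def hyp_form_def
  by (intro continuous_intros) (auto simp: H2xR_def H2_inner)

lemma barrier_deriv_along_curve: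
  assumes \<gamma>: "(\<gamma> has_vector_derivative v) (at s)" and H: "\<gamma> s \<in> H2xR"
  shows "((\<lambda>s. barrier \<beta> l T (\<gamma> s)) has_real_derivative barrier_deriv \<beta> l T (\<gamma> s) v) (at s)"
proof -
  have 1: "((\<lambda>s. fst (\<gamma> s)) has_vector_derivative fst v) (at s)"
    using bounded_linear.has_vector_derivative[OF bounded_linear_fst \<gamma>] .
  have 2: "((\<lambda>s. snd (\<gamma> s)) has_real_derivative snd v) (at s)"
    using bounded_linear.has_vector_derivative[OF bounded_linear_snd \<gamma>]
    by (simp add: has_real_derivative_iff_has_vector_derivative)
  have 3: "fst (\<gamma> s) \<in> H2" using H by (auto simp: H2xR_def)
  show ?thesis
    unfolding barrier_def barrier_deriv_def
    by (rule derivative_eq_intros hyp_form_deriv_along_curve[OF 1 3] 2 refl)+ (simp add: algebra_simps)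
qed

lemma barrier_second_deriv_along_curve:
  assumes \<gamma>: "(\<gamma> has_vector_derivative \<gamma>1 s) (at s)" and \<gamma>1: "(\<gamma>1 has_vector_derivative a) (at s)"
    and H: "\<gamma> s \<in> H2xR"
  shows "((\<lambda>s. barrier_deriv \<beta> l T (\<gamma> s) (\<gamma>1 s)) has_real_derivative
    barrier_hess \<beta> l T (\<gamma> s) (\<gamma>1 s)
    + barrier_deriv \<beta> l T (\<gamma> s) (a + christoffel H2xR_metric (\<gamma> s) (\<gamma>1 s) (\<gamma>1 s))) (at s)"
proof -
  have z: "((\<lambda>s. fst (\<gamma> s)) has_vector_derivative fst (\<gamma>1 s)) (at s)"
    using bounded_linear.has_vector_derivative[OF bounded_linear_fst \<gamma>] .
  have z1: "((\<lambda>s. fst (\<gamma>1 s)) has_vector_derivative fst a) (at s)"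
    using bounded_linear.has_vector_derivative[OF bounded_linear_fst \<gamma>1] .
  have t: "((\<lambda>s. snd (\<gamma> s)) has_real_derivative snd (\<gamma>1 s)) (at s)"
    using bounded_linear.has_vector_derivative[OF bounded_linear_snd \<gamma>]
    by (simp add: has_real_derivative_iff_has_vector_derivative)
  have t1: "((\<lambda>s. snd (\<gamma>1 s)) has_real_derivative snd a) (at s)"
    using bounded_linear.has_vector_derivative[OF bounded_linear_snd \<gamma>1]
    by (simp add: has_real_derivative_iff_has_vector_derivative)
  have 3: "fst (\<gamma> s) \<in> H2" using H by (auto simp: H2xR_def)
  note D = hyp_form_deriv_along_curve[OF z 3] 
    hyp_form_second_deriv_along_curve[where z="\<lambda>s. fst (\<gamma> s)" and ?z1.0="\<lambda>s. fst (\<gamma>1 s)", OF z z1 3]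
  have C: "fst (christoffel H2xR_metric (\<gamma> s) (\<gamma>1 s) (\<gamma>1 s)) =
      (2 / (1 - fst (\<gamma> s) \<bullet> fst (\<gamma> s))) *\<^sub>R ((2 * (fst (\<gamma> s) \<bullet> fst (\<gamma>1 s))) *\<^sub>R fst (\<gamma>1 s)
       - (fst (\<gamma>1 s) \<bullet> fst (\<gamma>1 s)) *\<^sub>R fst (\<gamma> s))"
    "snd (christoffel H2xR_metric (\<gamma> s) (\<gamma>1 s) (\<gamma>1 s)) = 0"
    by (simp_all add: christoffel_H2xR[OF H] power2_norm_eq_inner scaleR_left_distrib[symmetric])
  show ?thesis
    unfolding barrier_deriv_def barrier_hess_def fst_add snd_add C
    by (rule derivative_eq_intros D t t1 refl)+ (simp add: algebra_simps power2_eq_square)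
qed

section \<open>The trace of the Hessian on planes tangent to level sets\<close>

text \<open>
  In three dimensions the unit normal of the plane of \<open>(a1, \<tau>1)\<close>, \<open>(a2, \<tau>2)\<close> is their cross
  product. The vector \<open>(c G, - m)\<close> is a multiple of it, and \<open>\<tau>1\<^sup>2 + \<tau>2\<^sup>2\<close> is
  the squared length of the projection of the vertical unit vector to the plane.
\<close>

lemma adapted_plane_vertical_part:
  fixes a1 a2 G :: complex and \<tau>1 \<tau>2 c m :: real
  assumes "a1 \<bullet> a1 + \<tau>1 * \<tau>1 = 1" "a2 \<bullet> a2 + \<tau>2 * \<tau>2 = 1" "a1 \<bullet> a2 + \<tau>1 * \<tau>2 = 0"
    and "c * (G \<bullet> a1) = m * \<tau>1" "c * (G \<bullet> a2) = m * \<tau>2"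
  shows "(\<tau>1\<^sup>2 + \<tau>2\<^sup>2) * (c\<^sup>2 * (G \<bullet> G) + m\<^sup>2) = c\<^sup>2 * (G \<bullet> G)" "\<tau>1\<^sup>2 + \<tau>2\<^sup>2 \<le> 1"
proof -
  have gen: "(t1\<^sup>2 + t2\<^sup>2) * (p\<^sup>2 + q\<^sup>2 + m\<^sup>2) = p\<^sup>2 + q\<^sup>2 \<and> t1\<^sup>2 + t2\<^sup>2 \<le> 1"
    if h: "x1*x1 + y1*y1 + t1*t1 = 1" "x2*x2 + y2*y2 + t2*t2 = 1" "x1*x2+y1*y2+t1*t2=0"
      "p*x1+q*y1 = m*t1" "p*x2+q*y2=m*t2" for x1 y1 t1 x2 y2 t2 p q m :: real
  proof -
    \<comment> \<open>\<open>k\<close> is the vertical component of the normal, \<open>d\<close> its inner product with \<open>(p, q, - m)\<close>.\<close>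
    define d where "d = p*(y1*t2-t1*y2) + q*(t1*x2-x1*t2) - m*(x1*y2-y1*x2)"
    define k where "k = x1*y2-y1*x2"
    have 1: "k\<^sup>2 = 1 - (t1\<^sup>2+t2\<^sup>2)" using h(1-3) unfolding k_def by algebra
    have 2: "d * k = - m" using h unfolding k_def d_def by algebra
    have 3: "d\<^sup>2 = p\<^sup>2+q\<^sup>2+m\<^sup>2" using h unfolding d_def by algebra
    have "d\<^sup>2*k\<^sup>2 = m\<^sup>2" using 2 by algebra
    then have "(t1\<^sup>2 + t2\<^sup>2) * (p\<^sup>2 + q\<^sup>2 + m\<^sup>2) = p\<^sup>2 + q\<^sup>2" using 1 3 by algebra
    moreover have "t1\<^sup>2 + t2\<^sup>2 \<le> 1" using 1 zero_le_power2[of k] by linarith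
    ultimately show ?thesis ..
  qed
  have "G \<bullet> G = (Re G)\<^sup>2 + (Im G)\<^sup>2" by (simp add: inner_complex_def power2_eq_square)
  moreover have "(\<tau>1\<^sup>2 + \<tau>2\<^sup>2) * ((c * Re G)\<^sup>2 + (c * Im G)\<^sup>2 + m\<^sup>2) = (c * Re G)\<^sup>2 + (c * Im G)\<^sup>2 \<and> \<tau>1\<^sup>2 + \<tau>2\<^sup>2 \<le> 1"
    by (rule gen[of "Re a1" "Im a1" \<tau>1 "Re a2" "Im a2" \<tau>2])
       (use assms in \<open>simp_all add: inner_complex_def algebra_simps\<close>)
  ultimately show "(\<tau>1\<^sup>2 + \<tau>2\<^sup>2) * (c\<^sup>2 * (G \<bullet> G) + m\<^sup>2) = c\<^sup>2 * (G \<bullet> G)" "\<tau>1\<^sup>2 + \<tau>2\<^sup>2 \<le> 1"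
    by (simp_all add: power_mult_distrib distrib_left)
qed

text \<open>
  The plane spanned by \<open>v1\<close> and \<open>v2\<close> is tangent to the level set of the barrier, so its normal is
  parallel to the gradient. This determines the sum \<open>\<theta>\<close> of the squared vertical components wherever
  the gradient does not vanish, and then the trace of the Hessian on the plane is a function of the
  point only.
\<close>

lemma barrier_trace:
  assumes p: "p \<in> H2xR"
    and orth: "H2xR_metric p v1 v1 = 1" "H2xR_metric p v2 v2 = 1" "H2xR_metric p v1 v2 = 0"
    and crit: "barrier_deriv \<beta> l T p v1 = 0" "barrier_deriv \<beta> l T p v2 = 0"
  defines "h \<equiv> hyp_form \<beta> (fst p)" and "c \<equiv> cos (l * (snd p - T))" and "s \<equiv> sin (l * (snd p - T))"
  defines "G \<equiv> h\<^sup>2 - (1 - \<beta> \<bullet> \<beta>)" and "\<theta> \<equiv> (snd v1)\<^sup>2 + (snd v2)\<^sup>2"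
  shows "c * (barrier_hess \<beta> l T p v1 + barrier_hess \<beta> l T p v2)
      = h * (2 * c\<^sup>2 - \<theta> * (c\<^sup>2 + 2 * l\<^sup>2 * s\<^sup>2 + l\<^sup>2 * c\<^sup>2))"
    and "\<theta> * (c\<^sup>2 * G + (l * h * s)\<^sup>2) = c\<^sup>2 * G" and "\<theta> \<le> 1"
proof -
  define w g where "w = 1 - fst p \<bullet> fst p" and "g = hyp_form_grad \<beta> (fst p)"
  \<comment> \<open>In the orthonormal frame the metric becomes Euclidean.\<close>
  define a1 a2 where "a1 = (2 / w) *\<^sub>R fst v1" and "a2 = (2 / w) *\<^sub>R fst v2"
  have G: "g \<bullet> g = G"
    unfolding g_def G_def h_def by (rule norm_hyp_form_grad) (use p in \<open>auto simp: H2xR_def\<close>)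
  have a: "a1 \<bullet> a1 + snd v1 * snd v1 = 1" "a2 \<bullet> a2 + snd v2 * snd v2 = 1" "a1 \<bullet> a2 + snd v1 * snd v2 = 0"
    using orth unfolding H2xR_metric_def power2_norm_eq_inner
    by (simp_all add: a1_def a2_def w_def power2_eq_square)
  have k: "c * (g \<bullet> a1) = (l * h * s) * snd v1" "c * (g \<bullet> a2) = (l * h * s) * snd v2"
    using crit by (simp_all add: barrier_deriv_def a1_def a2_def w_def g_def h_def c_def s_def mult_ac)
  show "\<theta> * (c\<^sup>2 * G + (l * h * s)\<^sup>2) = c\<^sup>2 * G" "\<theta> \<le> 1"
    using adapted_plane_vertical_part[OF a k] by (simp_all add: \<theta>_def G)
  have hess: "barrier_hess \<beta> l T p v = h * c * (((2 / w) *\<^sub>R fst v) \<bullet> ((2 / w) *\<^sub>R fst v))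
      - 2 * l * s * (g \<bullet> ((2 / w) *\<^sub>R fst v)) * snd v - l\<^sup>2 * h * c * (snd v)\<^sup>2" for v
    by (simp add: barrier_hess_def h_def c_def s_def w_def g_def power2_eq_square)
  show "c * (barrier_hess \<beta> l T p v1 + barrier_hess \<beta> l T p v2)
      = h * (2 * c\<^sup>2 - \<theta> * (c\<^sup>2 + 2 * l\<^sup>2 * s\<^sup>2 + l\<^sup>2 * c\<^sup>2))"
    unfolding hess a1_def[symmetric] a2_def[symmetric] \<theta>_def using a(1,2) k by algebra
qed

text \<open>
  For \<open>N \<noteq> 0\<close> the trace has the sign of \<open>(1 - l\<^sup>2) c\<^sup>2 |\<nabla>h|\<^sup>2 + 2 l\<^sup>2 s\<^sup>2\<close>. The case
  \<open>N = 0\<close> is that of a critical point of the barrier, on the axis over the centre; there the Hessian is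
  \<open>g\<close> on horizontal vectors and \<open>- l\<^sup>2\<close> on the vertical unit vector, so its trace on any
  plane is at least \<open>1 - l\<^sup>2\<close>.
\<close>

lemma barrier_trace_pos:
  assumes p: "p \<in> H2xR"
    and orth: "H2xR_metric p v1 v1 = 1" "H2xR_metric p v2 v2 = 1" "H2xR_metric p v1 v2 = 0"
    and crit: "barrier_deriv 0 l T p v1 = 0" "barrier_deriv 0 l T p v2 = 0"
    and cos_pos: "cos (l * (snd p - T)) > 0" and l: "0 < l" "l < 1"
  shows "barrier_hess 0 l T p v1 + barrier_hess 0 l T p v2 > 0"
proof -
  define h c s where "h = hyp_form 0 (fst p)" and "c = cos (l * (snd p - T))"
    and "s = sin (l * (snd p - T))"
  define \<theta> G where "\<theta> = (snd v1)\<^sup>2 + (snd v2)\<^sup>2" and "G = h\<^sup>2 - 1"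
  define Q N where "Q = 2 * c\<^sup>2 - \<theta> * (c\<^sup>2 + 2 * l\<^sup>2 * s\<^sup>2 + l\<^sup>2 * c\<^sup>2)" and "N = c\<^sup>2 * G + (l * h * s)\<^sup>2"
  have h: "h \<ge> 1" using hyp_form_0_ge_1 p by (auto simp: h_def H2xR_def)
  have G: "G \<ge> 0" using h by (simp add: G_def)
  have c: "c > 0" using cos_pos by (simp add: c_def)
  have l2: "l\<^sup>2 < 1" using l by (simp add: power_less_one_iff)
  have tr: "c * (barrier_hess 0 l T p v1 + barrier_hess 0 l T p v2) = h * Q"
    and \<theta>: "\<theta> * N = c\<^sup>2 * G" and \<theta>1: "\<theta> \<le> 1"
    using barrier_trace[OF p orth crit] unfolding h_def c_def s_def \<theta>_def Q_def N_def G_def by simp_all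
  have "Q > 0"
  proof (cases "N = 0")
    case True
    have "c\<^sup>2 * G \<ge> 0" "(l * h * s)\<^sup>2 \<ge> 0" using G by simp_all
    with True have "(l * h * s)\<^sup>2 = 0" unfolding N_def by linarith
    then have "s = 0" using l h by simp
    moreover from this have "c\<^sup>2 = 1" using sin_cos_squared_add[of "l * (snd p - T)"] by (simp add: s_def c_def)
    ultimately have "Q = 2 - \<theta> * (1 + l\<^sup>2)" by (simp add: Q_def)
    moreover have "\<theta> * (1 + l\<^sup>2) \<le> 1 * (1 + l\<^sup>2)" by (rule mult_right_mono) (use \<theta>1 in auto)
    ultimately show ?thesis using l2 by simp
  next
    case False
    have "Q * N = c\<^sup>2 * ((1 - l\<^sup>2) * c\<^sup>2 * G + 2 * l\<^sup>2 * s\<^sup>2)"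
      using \<theta> unfolding Q_def N_def G_def by algebra
    moreover have "(1 - l\<^sup>2) * c\<^sup>2 * G + 2 * l\<^sup>2 * s\<^sup>2 > 0"
    proof (cases "G = 0")
      case True
      then have "s \<noteq> 0" using False by (auto simp: N_def)
      then show ?thesis using True l by simp
    next
      case False
      then have "(1 - l\<^sup>2) * c\<^sup>2 * G > 0" using l2 c G by simp
      then show ?thesis by (simp add: add_pos_nonneg)
    qed
    ultimately have "Q * N > 0" using c by simp
    moreover have "N \<ge> 0" using G by (simp add: N_def)
    ultimately show ?thesis by (simp add: zero_less_mult_iff)
  qed
  then have "c * (barrier_hess 0 l T p v1 + barrier_hess 0 l T p v2) > 0"
    using tr h by simp
  then show ?thesis using c by (simp add: zero_less_mult_iff)
qed

text \<open>
  For an ideal point \<open>|\<nabla>h| = h\<close>, so the gradient of the barrier never vanishes and the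
  trace has the sign of \<open>1 - l\<^sup>2\<close>.
\<close>

lemma barrier_trace_neg:
  assumes p: "p \<in> H2xR"
    and orth: "H2xR_metric p v1 v1 = 1" "H2xR_metric p v2 v2 = 1" "H2xR_metric p v1 v2 = 0"
    and crit: "barrier_deriv \<beta> l T p v1 = 0" "barrier_deriv \<beta> l T p v2 = 0"
    and cos_pos: "cos (l * (snd p - T)) > 0" and l: "1 < l" and \<beta>: "\<beta> \<in> bdry_H2"
  shows "barrier_hess \<beta> l T p v1 + barrier_hess \<beta> l T p v2 < 0"
proof -
  define h c s where "h = hyp_form \<beta> (fst p)" and "c = cos (l * (snd p - T))"
    and "s = sin (l * (snd p - T))"
  define \<theta> where "\<theta> = (snd v1)\<^sup>2 + (snd v2)\<^sup>2"
  define Q N where "Q = 2 * c\<^sup>2 - \<theta> * (c\<^sup>2 + 2 * l\<^sup>2 * s\<^sup>2 + l\<^sup>2 * c\<^sup>2)" and "N = c\<^sup>2 * h\<^sup>2 + (l * h * s)\<^sup>2"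
  have h: "h > 0" using hyp_form_ideal_pos[OF \<beta>] p by (auto simp: h_def H2xR_def)
  have c: "c > 0" using cos_pos by (simp add: c_def)
  have l2: "1 < l\<^sup>2" using l by simp
  have \<beta>1: "\<beta> \<bullet> \<beta> = 1" using \<beta> by (simp add: bdry_H2_def norm_eq_1)
  have tr: "c * (barrier_hess \<beta> l T p v1 + barrier_hess \<beta> l T p v2) = h * Q"
    and \<theta>: "\<theta> * N = c\<^sup>2 * h\<^sup>2"
    using barrier_trace[OF p orth crit] unfolding h_def c_def s_def \<theta>_def Q_def N_def \<beta>1 by simp_all
  have "Q * N = (1 - l\<^sup>2) * (c\<^sup>2 * c\<^sup>2 * h\<^sup>2)"
    using \<theta> unfolding Q_def N_def by algebra
  moreover have "(1 - l\<^sup>2) * (c\<^sup>2 * c\<^sup>2 * h\<^sup>2) < 0"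
    by (rule mult_neg_pos) (use l2 c h in auto)
  moreover have "N \<ge> 0" by (simp add: N_def)
  ultimately have "Q < 0" using mult_nonneg_nonneg[of Q N] by linarith
  then have "c * (barrier_hess \<beta> l T p v1 + barrier_hess \<beta> l T p v2) < 0"
    using tr h by (simp add: mult_less_0_iff)
  then show ?thesis using c by (simp add: mult_less_0_iff)
qed

section \<open>Frames and traces on immersed surfaces\<close>

lemma matrix_inv_eqI:
  fixes A B :: "real^'n^'n"
  assumes "A ** B = mat 1" "B ** A = mat 1"
  shows "matrix_inv A = B"
proof -
  have "A ** matrix_inv A = mat 1 \<and> matrix_inv A ** A = mat 1"
    unfolding matrix_inv_def by (rule someI[of _ B]) (use assms in simp)
  then show ?thesis using assms by (metis matrix_mul_assoc matrix_mul_lid matrix_mul_rid)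
qed

text \<open>
  Gram-Schmidt applied to the standard basis; the vectors \<open>e1\<close>, \<open>e2\<close> are then orthonormal for \<open>A\<close>,
  and the sum of their outer squares is the inverse of \<open>A\<close>.
\<close>

lemma matrix_inv_2_frame:
  fixes A :: "real^2^2"
  assumes sym: "A $ 2 $ 1 = A $ 1 $ 2" and pos: "A $ 1 $ 1 > 0" "A $ 1 $ 1 * A $ 2 $ 2 - (A $ 1 $ 2)\<^sup>2 > 0"
  obtains e1 e2 :: "real^2" where "e1 \<bullet> (A *v e1) = 1" "e2 \<bullet> (A *v e2) = 1" "e1 \<bullet> (A *v e2) = 0"
    "\<And>i j. matrix_inv A $ i $ j = e1 $ i * e1 $ j + e2 $ i * e2 $ j"
proof -
  define a b d where "a = A $ 1 $ 1" and "b = A $ 1 $ 2" and "d = a * A $ 2 $ 2 - b\<^sup>2"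
  define p q where "p = 1 / sqrt a" and "q = 1 / sqrt (a * d)"
  have ad: "a > 0" "d > 0" using pos by (simp_all add: a_def b_def d_def)
  have p: "a * p\<^sup>2 = 1" using ad by (simp add: p_def power_divide)
  have q: "a * d * q\<^sup>2 = 1" using ad by (simp add: q_def power_divide)
  define e1 e2 :: "real^2" where "e1 = vector [p, 0]" and "e2 = vector [- b * q, a * q]"
  define B :: "real^2^2" where "B = (\<chi> i j. e1 $ i * e1 $ j + e2 $ i * e2 $ j)"
  have dc: "d = a * A $ 2 $ 2 - b\<^sup>2" by (simp add: d_def)
  note S = vec_eq_iff forall_2 sum_2 matrix_matrix_mult_def matrix_vector_mult_def inner_vec_def mat_def
    e1_def e2_def B_def vector_2 sym a_def[symmetric] b_def[symmetric]
  have p1: "a * (p * p) = 1" and q1: "a * ((a * A $ 2 $ 2 - b * b) * (q * q)) = 1"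
    using p q by (simp_all add: power2_eq_square dc mult_ac)
  have "A ** B = mat 1"
    by (simp add: S, intro conjI; use p1 q1 in algebra)
  moreover have "B ** A = mat 1"
    by (simp add: S, intro conjI; use p1 q1 in algebra)
  ultimately have "matrix_inv A = B" by (rule matrix_inv_eqI)
  moreover have "e1 \<bullet> (A *v e1) = 1"
    by (simp add: S) (use p1 in algebra)
  moreover have "e2 \<bullet> (A *v e2) = 1"
    by (simp add: S) (use q1 in algebra)
  moreover have "e1 \<bullet> (A *v e2) = 0"
    by (simp add: S)
  ultimately show ?thesis using that[of e1 e2] by (simp add: B_def)
qed

lemma smooth_on_directional:
  assumes "smooth_on X V" "v \<in> V"
  shows "X differentiable (at v)" "(\<lambda>x. frechet_derivative X (at x) e) differentiable (at v)"
proof -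
  have "C_k_on (Suc (Suc 0)) X V" using assms(1) unfolding smooth_on_def by blast
  then show "X differentiable (at v)" "(\<lambda>x. frechet_derivative X (at x) e) differentiable (at v)"
    using assms(2) by auto
qed

lemma real2_expand: "(e::real^2) = e $ 1 *\<^sub>R axis 1 1 + e $ 2 *\<^sub>R axis 2 1"
  by (simp add: vec_eq_iff forall_2 axis_def)

lemma frechet_derivative_coord:
  assumes "X differentiable (at u)"
  shows "frechet_derivative X (at u) e = e $ 1 *\<^sub>R coord_deriv 1 X u + e $ 2 *\<^sub>R coord_deriv 2 X u"
proof -
  have "linear (frechet_derivative X (at u))" using assms by (rule linear_frechet_derivative)
  then show ?thesis
    unfolding coord_deriv_def by (subst real2_expand) (simp only: linear_add linear_scale)
qed

lemma second_derivative_coord: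
  assumes V: "open V" "u \<in> V" and X: "smooth_on X V"
  shows "frechet_derivative (\<lambda>x. frechet_derivative X (at x) e) (at u) e =
    (\<Sum>i\<in>UNIV. \<Sum>j\<in>UNIV. (e $ i * e $ j) *\<^sub>R coord_deriv i (coord_deriv j X) u)"
proof -
  have D: "(coord_deriv j X has_derivative frechet_derivative (coord_deriv j X) (at u)) (at u)" for j
    using smooth_on_directional(2)[OF X V(2), of "axis j 1"]
    unfolding coord_deriv_def[abs_def] by (simp add: frechet_derivative_works)
  have "((\<lambda>x. e $ 1 *\<^sub>R coord_deriv 1 X x + e $ 2 *\<^sub>R coord_deriv 2 X x) has_derivative
     (\<lambda>h. e $ 1 *\<^sub>R frechet_derivative (coord_deriv 1 X) (at u) h
        + e $ 2 *\<^sub>R frechet_derivative (coord_deriv 2 X) (at u) h)) (at u)"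
    by (intro has_derivative_add has_derivative_scaleR_right D)
  then have "((\<lambda>x. frechet_derivative X (at x) e) has_derivative
     (\<lambda>h. e $ 1 *\<^sub>R frechet_derivative (coord_deriv 1 X) (at u) h
        + e $ 2 *\<^sub>R frechet_derivative (coord_deriv 2 X) (at u) h)) (at u)"
    by (rule has_derivative_transform_within_open[OF _ V])
       (simp add: frechet_derivative_coord[OF smooth_on_directional(1)[OF X]])
  from fun_cong[OF frechet_derivative_at[OF this], of e, symmetric]
  have "frechet_derivative (\<lambda>x. frechet_derivative X (at x) e) (at u) e =
      e $ 1 *\<^sub>R frechet_derivative (coord_deriv 1 X) (at u) e
        + e $ 2 *\<^sub>R frechet_derivative (coord_deriv 2 X) (at u) e" .
  moreover have "frechet_derivative (coord_deriv j X) (at u) e =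
     e $ 1 *\<^sub>R coord_deriv 1 (coord_deriv j X) u + e $ 2 *\<^sub>R coord_deriv 2 (coord_deriv j X) u" for j
    by (rule frechet_derivative_coord) (use D in \<open>auto simp: differentiable_def\<close>)
  ultimately show ?thesis
    by (simp add: sum_2 algebra_simps)
qed

lemma christoffel_linear_left:
  assumes "p \<in> H2xR"
  shows "christoffel H2xR_metric p (a *\<^sub>R v + b *\<^sub>R v') w =
    a *\<^sub>R christoffel H2xR_metric p v w + b *\<^sub>R christoffel H2xR_metric p v' w"
proof -
  have "k *\<^sub>R ((a * x + b * x') *\<^sub>R w + y *\<^sub>R (a *\<^sub>R v + b *\<^sub>R v') - (a * z + b * z') *\<^sub>R q) =
    a *\<^sub>R k *\<^sub>R (x *\<^sub>R w + y *\<^sub>R v - z *\<^sub>R q) + b *\<^sub>R k *\<^sub>R (x' *\<^sub>R w + y *\<^sub>R v' - z' *\<^sub>R q)"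
    for k x x' y z z' :: real and v v' w q :: complex
    by (simp add: complex_eq_iff) (simp add: algebra_simps)
  then show ?thesis
    unfolding christoffel_H2xR[OF assms] by (simp add: inner_add_left inner_add_right)
qed

lemma christoffel_sym:
  assumes "p \<in> H2xR"
  shows "christoffel H2xR_metric p v w = christoffel H2xR_metric p w v"
  unfolding christoffel_H2xR[OF assms] by (simp add: inner_commute add.commute)

lemma christoffel_linear_right:
  assumes "p \<in> H2xR"
  shows "christoffel H2xR_metric p w (a *\<^sub>R v + b *\<^sub>R v') =
    a *\<^sub>R christoffel H2xR_metric p w v + b *\<^sub>R christoffel H2xR_metric p w v'"
  using christoffel_linear_left[OF assms] by (simp add: christoffel_sym[OF assms, of w])

text \<open>
  The left-hand side is the covariant acceleration at \<open>u\<close> of the image under \<open>X\<close> of the line through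
  \<open>u\<close> in direction \<open>e\<close>. It is quadratic in \<open>e\<close>, so its sum over an orthonormal frame is
  a trace.
\<close>

lemma second_covariant_derivative:
  assumes V: "open V" "u \<in> V" and X: "smooth_on X V" and H: "X u \<in> H2xR"
  shows "frechet_derivative (\<lambda>x. frechet_derivative X (at x) e) (at u) e
      + christoffel H2xR_metric (X u) (frechet_derivative X (at u) e) (frechet_derivative X (at u) e) =
    (\<Sum>i\<in>UNIV. \<Sum>j\<in>UNIV. (e $ i * e $ j) *\<^sub>R cov_deriv H2xR_metric X u i j)"
proof -
  have "christoffel H2xR_metric (X u) (frechet_derivative X (at u) e) (frechet_derivative X (at u) e) =
    (\<Sum>i\<in>UNIV. \<Sum>j\<in>UNIV. (e $ i * e $ j) *\<^sub>R
       christoffel H2xR_metric (X u) (coord_deriv i X u) (coord_deriv j X u))"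
    unfolding frechet_derivative_coord[OF smooth_on_directional(1)[OF X V(2)]] sum_2
      christoffel_linear_left[OF H] christoffel_linear_right[OF H]
    by (simp add: algebra_simps)
  then show ?thesis
    unfolding second_derivative_coord[OF V X] cov_deriv_def
    by (simp only: scaleR_add_right sum.distrib)
qed

lemma orthonormal_frame:
  assumes X: "X differentiable (at u)" and H: "X u \<in> H2xR" and inj: "inj (frechet_derivative X (at u))"
  obtains e1 e2 :: "real^2" where
    "H2xR_metric (X u) (frechet_derivative X (at u) e1) (frechet_derivative X (at u) e1) = 1"
    "H2xR_metric (X u) (frechet_derivative X (at u) e2) (frechet_derivative X (at u) e2) = 1"
    "H2xR_metric (X u) (frechet_derivative X (at u) e1) (frechet_derivative X (at u) e2) = 0"
    "\<And>i j. matrix_inv (first_form H2xR_metric X u) $ i $ j = e1 $ i * e1 $ j + e2 $ i * e2 $ j"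
proof -
  define g where "g = H2xR_metric (X u)"
  define D where "D = frechet_derivative X (at u)"
  define A where "A = first_form H2xR_metric X u"
  have lin: "linear D" unfolding D_def using X by (rule linear_frechet_derivative)
  have pos: "g v v > 0" if "v \<noteq> 0" for v
  proof -
    have "1 - (norm (fst (X u)))\<^sup>2 \<noteq> 0"
      using H by (auto simp: H2xR_def H2_inner power2_norm_eq_inner)
    then have k: "4 / (1 - (norm (fst (X u)))\<^sup>2)\<^sup>2 > 0" by simp
    show ?thesis
    proof (cases "fst v = 0")
      case True
      then have "snd v \<noteq> 0" using that by (auto simp: prod_eq_iff)
      then show ?thesis using True by (simp add: g_def H2xR_metric_def flip: power2_eq_square)
    next
      case False
      then have "4 / (1 - (norm (fst (X u)))\<^sup>2)\<^sup>2 * (fst v \<bullet> fst v) > 0" using k by (intro mult_pos_pos) auto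
      moreover have "snd v * snd v \<ge> 0" by simp
      ultimately show ?thesis unfolding g_def H2xR_metric_def by linarith
    qed
  qed
  have gA: "g (D x) (D y) = x \<bullet> (A *v y)" for x y
    unfolding g_def D_def frechet_derivative_coord[OF X] A_def
    by (simp add: first_form_def sum_2 inner_vec_def matrix_vector_mult_def H2xR_metric_def
        inner_add_left inner_add_right inner_commute algebra_simps add_divide_distrib)
  have Apos: "x \<bullet> (A *v x) > 0" if "x \<noteq> 0" for x
  proof -
    have "D x \<noteq> 0" using inj that linear_0[OF lin] unfolding D_def[symmetric] by (auto dest: injD[of D x 0])
    then show ?thesis using pos gA by metis
  qed
  have sym: "A $ 2 $ 1 = A $ 1 $ 2"
    by (simp add: A_def first_form_def H2xR_metric_def inner_commute mult.commute)
  have A11: "A $ 1 $ 1 > 0"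
    using Apos[of "axis 1 1"] by (simp add: axis_eq_0_iff inner_axis' matrix_vector_mult_basis column_def)
  \<comment> \<open>The value of the form at \<open>(- b, a)\<close>, with \<open>a\<close>, \<open>b\<close> its first row, is \<open>a\<close> times its determinant.\<close>
  have "vector [- A $ 1 $ 2, A $ 1 $ 1] \<bullet> (A *v vector [- A $ 1 $ 2, A $ 1 $ 1]) > 0"
    by (rule Apos) (use A11 in \<open>simp add: vec_eq_iff forall_2\<close>)
  also have "vector [- A $ 1 $ 2, A $ 1 $ 1] \<bullet> (A *v vector [- A $ 1 $ 2, A $ 1 $ 1])
     = A $ 1 $ 1 * (A $ 1 $ 1 * A $ 2 $ 2 - (A $ 1 $ 2)\<^sup>2)"
    by (simp add: inner_vec_def matrix_vector_mult_def sum_2 sym power2_eq_square algebra_simps)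
  finally have "A $ 1 $ 1 * A $ 2 $ 2 - (A $ 1 $ 2)\<^sup>2 > 0" using A11 by (simp add: zero_less_mult_iff)
  from matrix_inv_2_frame[OF sym A11 this] obtain e1 e2 where
    "e1 \<bullet> (A *v e1) = 1" "e2 \<bullet> (A *v e2) = 1" "e1 \<bullet> (A *v e2) = 0"
    "\<And>i j. matrix_inv A $ i $ j = e1 $ i * e1 $ j + e2 $ i * e2 $ j" by blast
  then show ?thesis using that[of e1 e2] unfolding gA[symmetric] by (simp add: g_def D_def A_def)
qed

text \<open>
  A form that annihilates the tangent plane does not see the difference between a vector and its
  normal part, so its value on the trace of the covariant derivatives is its value on twice the mean curvature
  vector.
\<close>

lemma minimal_trace_cov:
  assumes L: "linear L" "\<And>i. L (coord_deriv i X u) = (0::real)"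
    and H0: "mean_curvature_vector g X u = 0"
  shows "(\<Sum>i\<in>UNIV. \<Sum>j\<in>UNIV. matrix_inv (first_form g X u) $ i $ j * L (cov_deriv g X u i j)) = 0"
proof -
  have N: "L (normal_part g X u v) = L v" for v
    unfolding normal_part_def by (simp add: linear_diff[OF L(1)] linear_sum[OF L(1)] linear_scale[OF L(1)] L(2))
  have "L (mean_curvature_vector g X u) = 0" using H0 linear_0[OF L(1)] by simp
  then show ?thesis
    unfolding mean_curvature_vector_def
    by (simp add: linear_sum[OF L(1)] linear_scale[OF L(1)] N)
qed

section \<open>Extrema of the barrier on minimal surfaces\<close>

lemma second_derivative_at_local_max:
  fixes f f' :: "real \<Rightarrow> real"
  assumes max: "\<forall>\<^sub>F y in nhds x. f y \<le> f x"
    and f: "\<forall>\<^sub>F y in nhds x. (f has_real_derivative f' y) (at y)"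
    and f': "(f' has_real_derivative d) (at x)"
  shows "f' x = 0" "d \<le> 0"
proof -
  from max f have "\<forall>\<^sub>F y in nhds x. f y \<le> f x \<and> (f has_real_derivative f' y) (at y)"
    by eventually_elim simp
  then obtain e where e: "e > 0" "\<And>y. dist y x < e \<Longrightarrow> f y \<le> f x"
    "\<And>y. dist y x < e \<Longrightarrow> (f has_real_derivative f' y) (at y)"
    unfolding eventually_nhds_metric by blast
  show 0: "f' x = 0"
    by (rule DERIV_local_max[OF e(3) e(1)]) (use e in \<open>auto simp: dist_real_def\<close>)
  show "d \<le> 0"
  proof (rule ccontr)
    assume "\<not> d \<le> 0"
    then obtain \<delta> where \<delta>: "\<delta> > 0" "\<And>h. 0 < h \<Longrightarrow> h < \<delta> \<Longrightarrow> f' x < f' (x + h)"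
      using DERIV_pos_inc_right[OF f'] by force
    \<comment> \<open>\<open>f'\<close> is positive just to the right of \<open>x\<close>, so \<open>f\<close> increases there.\<close>
    define h where "h = min e \<delta> / 2"
    have h: "0 < h" "h < e" "h < \<delta>" using e(1) \<delta>(1) by (auto simp: h_def)
    obtain y where "x < y" "y < x + h" "f (x + h) - f x = (x + h - x) * f' y"
      using MVT2[of x "x + h" f f'] h e(3) by (auto simp: dist_real_def)
    then show False
      using e(2)[of "x + h"] \<delta>(2)[of "y - x"] h 0
      by (auto simp: dist_real_def zero_less_mult_iff)
         (smt (verit) mult_pos_pos)
  qed
qed

text \<open>
  At an extremum of the barrier along the surface, compare along the lines of the parameter
  domain in two orthonormal directions: the first derivatives vanish, and the second derivatives have
  a sign. The sum of the second derivatives is the trace of the ambient Hessian plus the differential of the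
  barrier applied to the trace of the second fundamental form, which is zero. The factor \<open>\<sigma>\<close> is
  positive for a maximum and negative for a minimum.
\<close>

lemma barrier_extremum_at_minimal_point:
  fixes X :: "real^2 \<Rightarrow> complex \<times> real" and \<sigma> :: real
  assumes V: "open V" "u \<in> V" and X: "smooth_on X V" and H: "X ` V \<subseteq> H2xR"
    and inj: "inj (frechet_derivative X (at u))"
    and min: "mean_curvature_vector H2xR_metric X u = 0"
    and max: "\<forall>\<^sub>F v in nhds u. \<sigma> * barrier \<beta> l T (X v) \<le> \<sigma> * barrier \<beta> l T (X u)"
    and \<sigma>: "\<sigma> \<noteq> 0"
  obtains v1 v2 where "H2xR_metric (X u) v1 v1 = 1" "H2xR_metric (X u) v2 v2 = 1" "H2xR_metric (X u) v1 v2 = 0"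
    "barrier_deriv \<beta> l T (X u) v1 = 0" "barrier_deriv \<beta> l T (X u) v2 = 0"
    "\<sigma> * (barrier_hess \<beta> l T (X u) v1 + barrier_hess \<beta> l T (X u) v2) \<le> 0"
proof -
  define D where "D = frechet_derivative X (at u)"
  define cov where "cov e = frechet_derivative (\<lambda>x. frechet_derivative X (at x) e) (at u) e
      + christoffel H2xR_metric (X u) (D e) (D e)" for e
  have Hu: "X u \<in> H2xR" using H V(2) by auto
  have line: "barrier_deriv \<beta> l T (X u) (D e) = 0"
    "\<sigma> * (barrier_hess \<beta> l T (X u) (D e) + barrier_deriv \<beta> l T (X u) (cov e)) \<le> 0" for e
  proof -
    define \<gamma> \<gamma>1 where "\<gamma> s = X (u + s *\<^sub>R e)" and "\<gamma>1 s = frechet_derivative X (at (u + s *\<^sub>R e)) e" for s :: real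
    have "((\<lambda>s. u + s *\<^sub>R e) \<longlongrightarrow> u + 0 *\<^sub>R e) (nhds 0)"
      by (intro tendsto_intros filterlim_ident)
    then have lim: "filterlim (\<lambda>s. u + s *\<^sub>R e) (nhds u) (nhds 0)" by simp
    have aff: "((\<lambda>s. u + s *\<^sub>R e) has_vector_derivative e) (at s)" for s :: real
      by (auto intro!: derivative_eq_intros simp: has_vector_derivative_def)
    have d: "(\<gamma> has_vector_derivative \<gamma>1 s) (at s)" if "u + s *\<^sub>R e \<in> V" for s
      using diff_chain_at[OF aff[of s, unfolded has_vector_derivative_def]
          frechet_derivative_works[THEN iffD1, OF smooth_on_directional(1)[OF X that]]]
      unfolding \<gamma>_def \<gamma>1_def has_vector_derivative_def o_def
      by (simp add: linear_scale[OF linear_frechet_derivative[OF smooth_on_directional(1)[OF X that]]])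
    have d2: "(\<gamma>1 has_vector_derivative frechet_derivative (\<lambda>x. frechet_derivative X (at x) e) (at u) e) (at 0)"
    proof -
      have df: "(\<lambda>x. frechet_derivative X (at x) e) differentiable (at u)" 
        by (rule smooth_on_directional(2)[OF X V(2)])
      have "((\<lambda>x. frechet_derivative X (at x) e) has_derivative
          frechet_derivative (\<lambda>x. frechet_derivative X (at x) e) (at u)) (at (u + 0 *\<^sub>R e))"
        using df by (simp add: frechet_derivative_works)
      from diff_chain_at[OF aff[of 0, unfolded has_vector_derivative_def] this]
      show ?thesis
        unfolding \<gamma>1_def[abs_def] has_vector_derivative_def o_def
        by (simp add: linear_scale[OF linear_frechet_derivative[OF df]])
    qed
    have inV: "\<forall>\<^sub>F s in nhds 0. u + s *\<^sub>R e \<in> V"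
      by (rule eventually_compose_filterlim[OF eventually_nhds_in_open[OF V] lim])
    have 1: "\<forall>\<^sub>F s in nhds 0. ((\<lambda>s. \<sigma> * barrier \<beta> l T (\<gamma> s)) has_real_derivative
        \<sigma> * barrier_deriv \<beta> l T (\<gamma> s) (\<gamma>1 s)) (at s)"
      using inV
    proof eventually_elim
      case (elim s)
      then have "\<gamma> s \<in> H2xR" using H by (auto simp: \<gamma>_def)
      from barrier_deriv_along_curve[OF d[OF elim] this] show ?case
        by (rule DERIV_cmult)
    qed
    have \<gamma>0: "\<gamma> 0 = X u" "\<gamma>1 0 = D e" by (simp_all add: \<gamma>_def \<gamma>1_def D_def)
    have 2: "((\<lambda>s. \<sigma> * barrier_deriv \<beta> l T (\<gamma> s) (\<gamma>1 s)) has_real_derivative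
        \<sigma> * (barrier_hess \<beta> l T (X u) (D e) + barrier_deriv \<beta> l T (X u) (cov e))) (at 0)"
      using DERIV_cmult[OF barrier_second_deriv_along_curve[OF d d2], of \<sigma> \<beta> l T] V(2) Hu
      unfolding cov_def \<gamma>0 by simp
    have 3: "\<forall>\<^sub>F s in nhds 0. \<sigma> * barrier \<beta> l T (\<gamma> s) \<le> \<sigma> * barrier \<beta> l T (\<gamma> 0)"
      using eventually_compose_filterlim[OF max lim] unfolding \<gamma>0 unfolding \<gamma>_def .
    show "barrier_deriv \<beta> l T (X u) (D e) = 0"
      using second_derivative_at_local_max(1)[OF 3 1 2] \<sigma> by (simp add: \<gamma>0)
    show "\<sigma> * (barrier_hess \<beta> l T (X u) (D e) + barrier_deriv \<beta> l T (X u) (cov e)) \<le> 0"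
      by (rule second_derivative_at_local_max(2)[OF 3 1 2])
  qed
  obtain e1 e2 where orth: "H2xR_metric (X u) (D e1) (D e1) = 1" "H2xR_metric (X u) (D e2) (D e2) = 1"
      "H2xR_metric (X u) (D e1) (D e2) = 0"
    and inv: "\<And>i j. matrix_inv (first_form H2xR_metric X u) $ i $ j = e1 $ i * e1 $ j + e2 $ i * e2 $ j"
    using orthonormal_frame[OF smooth_on_directional(1)[OF X V(2)] Hu inj] unfolding D_def by metis
  define L where "L = barrier_deriv \<beta> l T (X u)"
  have L: "linear L" unfolding L_def by (rule linear_barrier_deriv)
  have L0: "L (coord_deriv i X u) = 0" for i
    using line(1)[of "axis i 1"] by (simp add: L_def D_def coord_deriv_def)
  have "cov e = (\<Sum>i\<in>UNIV. \<Sum>j\<in>UNIV. (e $ i * e $ j) *\<^sub>R cov_deriv H2xR_metric X u i j)" for e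
    unfolding cov_def D_def by (rule second_covariant_derivative[OF V X Hu])
  then have "L (cov e1) + L (cov e2) =
      (\<Sum>i\<in>UNIV. \<Sum>j\<in>UNIV. matrix_inv (first_form H2xR_metric X u) $ i $ j * L (cov_deriv H2xR_metric X u i j))"
    unfolding inv by (simp add: linear_sum[OF L] linear_scale[OF L] sum.distrib distrib_right)
  also have "\<dots> = 0" by (rule minimal_trace_cov[OF L L0 min])
  finally have "L (cov e1) + L (cov e2) = 0" .
  then have "\<sigma> * L (cov e1) + \<sigma> * L (cov e2) = 0" by (simp flip: distrib_left)
  then have "\<sigma> * (barrier_hess \<beta> l T (X u) (D e1) + barrier_hess \<beta> l T (X u) (D e2)) \<le> 0"
    using line(2)[of e1] line(2)[of e2] by (simp add: L_def distrib_left)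
  then show ?thesis using that[OF orth line(1) line(1)] by blast
qed

lemma barrier_extremum_on_minimal_surface:
  fixes \<sigma> :: real
  assumes imm: "immersed_surface H2xR M \<A> F" and min: "minimal_immersion H2xR_metric \<A> F"
    and p: "p \<in> F ` topspace M" and W: "open W" "p \<in> W"
    and max: "\<And>q. q \<in> F ` topspace M \<Longrightarrow> q \<in> W \<Longrightarrow> \<sigma> * barrier \<beta> l T q \<le> \<sigma> * barrier \<beta> l T p"
    and \<sigma>: "\<sigma> \<noteq> 0"
  obtains v1 v2 where "H2xR_metric p v1 v1 = 1" "H2xR_metric p v2 v2 = 1" "H2xR_metric p v1 v2 = 0"
    "barrier_deriv \<beta> l T p v1 = 0" "barrier_deriv \<beta> l T p v2 = 0"
    "\<sigma> * (barrier_hess \<beta> l T p v1 + barrier_hess \<beta> l T p v2) \<le> 0"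
proof -
  from imm have surf: "smooth_surface M \<A>" and FH: "F ` topspace M \<subseteq> H2xR"
    by (auto simp: immersed_surface_def)
  from p obtain x where x: "x \<in> topspace M" "p = F x" by auto
  from x(1) surf obtain U \<phi> where c: "(U, \<phi>) \<in> \<A>" "x \<in> U"
    unfolding smooth_surface_def by auto
  define X u where "X = F \<circ> inv_into U \<phi>" and "u = \<phi> x"
  have chart: "openin M U" "open (\<phi> ` U)" "homeomorphic_map (subtopology M U) (top_of_set (\<phi> ` U)) \<phi>"
    using surf c(1) by (auto simp: smooth_surface_def)
  have UM: "U \<subseteq> topspace M" by (rule openin_subset[OF chart(1)])
  have injU: "inj_on \<phi> U"
    using homeomorphic_imp_injective_map[OF chart(3)] UM by (simp add: Int_absorb1)
  have u: "u \<in> \<phi> ` U" using c(2) by (simp add: u_def)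
  have Xu: "X u = p" using injU c(2) x(2) by (simp add: X_def u_def)
  have X: "smooth_on X (\<phi> ` U)" "inj (frechet_derivative X (at u))"
    using imm c(1) u by (auto simp: immersed_surface_def X_def)
  have XM: "X ` (\<phi> ` U) \<subseteq> F ` topspace M"
    using UM by (auto simp: X_def inv_into_into intro!: imageI) (metis imageI inv_into_into subsetD)
  have mc: "mean_curvature_vector H2xR_metric X u = 0"
    using min c(1) u by (auto simp: minimal_immersion_def X_def)
  have cont: "isCont X u"
    using smooth_on_directional(1)[OF X(1) u] differentiable_imp_continuous_within by blast
  have "\<forall>\<^sub>F v in nhds u. X v \<in> W"
    using cont W Xu unfolding isCont_def filterlim_def
    by (metis (mono_tags, lifting) cont continuous_at_open eventually_nhds)
  moreover have "\<forall>\<^sub>F v in nhds u. v \<in> \<phi> ` U" by (rule eventually_nhds_in_open[OF chart(2) u])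
  ultimately have "\<forall>\<^sub>F v in nhds u. \<sigma> * barrier \<beta> l T (X v) \<le> \<sigma> * barrier \<beta> l T (X u)"
  proof eventually_elim
    case (elim v)
    then have "X v \<in> F ` topspace M" using XM by blast
    from max[OF this elim(1)] show ?case unfolding Xu .
  qed
  from barrier_extremum_at_minimal_point[OF chart(2) u X(1) _ X(2) mc this \<sigma>] XM FH that
  show ?thesis unfolding Xu by blast
qed

section \<open>Confinement and nonexistence\<close>

text \<open>
  A sequence in a bounded slab can leave every compact set of \<open>H2xR\<close> only towards a point
  of the asymptotic boundary. This is what makes barriers attain their extrema.
\<close>

lemma compact_away_from_asymptotic_boundary:
  assumes \<Sigma>: "closedin (top_of_set H2xR) \<Sigma>" and C: "closed C" "C \<subseteq> UNIV \<times> {a..b}"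
    and disj: "asymptotic_boundary \<Sigma> \<inter> C = {}"
  shows "compact (\<Sigma> \<inter> C)"
proof -
  from \<Sigma> obtain C' where C': "closed C'" "\<Sigma> = H2xR \<inter> C'" by (auto simp: closedin_closed)
  have sub: "\<Sigma> \<inter> C \<subseteq> cball 0 1 \<times> {a..b}"
    using C C' by (auto simp: H2xR_def H2_def)
  then have "bounded (\<Sigma> \<inter> C)"
    by (rule bounded_subset[rotated]) (intro bounded_Times bounded_cball bounded_closed_interval)
  moreover have "closed (\<Sigma> \<inter> C)"
    unfolding closed_sequential_limits
  proof (intro allI impI, elim conjE)
    fix \<sigma> p
    assume \<sigma>: "\<forall>n. \<sigma> n \<in> \<Sigma> \<inter> C" "\<sigma> \<longlonglongrightarrow> p"
    have "closed (cball (0::complex) 1 \<times> {a..b})" by (intro closed_Times) auto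
    then have "p \<in> cball 0 1 \<times> {a..b}"
      by (rule closed_sequentially[OF _ _ \<sigma>(2)]) (use \<sigma>(1) sub in blast)
    moreover have pC: "p \<in> C" "p \<in> C'"
      using closed_sequentially[OF C(1) _ \<sigma>(2)] closed_sequentially[OF C'(1) _ \<sigma>(2)] \<sigma>(1) C'(2) by auto
    moreover have "fst p \<notin> sphere 0 1"
    proof
      assume "fst p \<in> sphere 0 1"
      then have "p \<in> asymptotic_boundary \<Sigma>"
        using \<sigma> by (auto simp: asymptotic_boundary_def bdry_H2_def mem_Times_iff)
      with disj pC(1) show False by auto
    qed
    ultimately have "p \<in> H2xR" by (auto simp: H2xR_def H2_def)
    with pC C'(2) show "p \<in> \<Sigma> \<inter> C" by auto
  qed
  ultimately show ?thesis by (simp add: compact_eq_bounded_closed)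
qed

text \<open>
  Here the barrier is \<open>cosh \<rho> * cos ((t - T) / 2)\<close>, where \<open>\<rho>\<close> is the distance to the axis. It
  vanishes on the two boundary slices of the slab and is positive in between, so if the surface enters
  the slab, a maximum over the compact part in the closed slab lies in the open one. There
  the trace would have to be both nonpositive and positive.
\<close>

lemma empty_in_slab_free_of_asymptotic_boundary:
  assumes imm: "immersed_surface H2xR M \<A> F" and min: "minimal_immersion H2xR_metric \<A> F"
    and \<Sigma>: "closedin (top_of_set H2xR) (F ` topspace M)"
    and disj: "asymptotic_boundary (F ` topspace M) \<inter> (UNIV \<times> {T - pi..T + pi}) = {}"
  shows "F ` topspace M \<inter> (UNIV \<times> {T - pi<..<T + pi}) = {}"
proof (rule ccontr)
  let ?f = "barrier 0 (1/2) T" and ?W = "UNIV \<times> {T - pi<..<T + pi} :: (complex \<times> real) set"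
  have H: "F ` topspace M \<subseteq> H2xR" using imm by (simp add: immersed_surface_def)
  assume "\<not> ?thesis"
  then obtain p0 where p0: "p0 \<in> F ` topspace M" "p0 \<in> ?W" by auto
  define K where "K = F ` topspace M \<inter> (UNIV \<times> {T - pi..T + pi})"
  have cos: "cos (1 / 2 * (t - T)) > 0" if "t \<in> {T - pi<..<T + pi}" for t
    by (rule cos_gt_zero_pi) (use that in auto)
  have pos: "?f p > 0" if "p \<in> F ` topspace M" "p \<in> ?W" for p
  proof -
    have "hyp_form 0 (fst p) \<ge> 1" using that(1) H by (intro hyp_form_0_ge_1) (auto simp: H2xR_def)
    moreover have "cos (1 / 2 * (snd p - T)) > 0" using that(2) by (intro cos) auto
    ultimately show ?thesis by (simp add: barrier_def)
  qed
  have "compact K" unfolding K_def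
    by (rule compact_away_from_asymptotic_boundary[OF \<Sigma> _ _ disj]) (auto intro!: closed_Times)
  moreover have "K \<noteq> {}" using p0 by (auto simp: K_def mem_Times_iff)
  moreover have "continuous_on K ?f"
    by (rule continuous_on_subset[OF continuous_on_barrier]) (use H in \<open>auto simp: K_def\<close>)
  ultimately obtain p where p: "p \<in> K" and max: "\<And>q. q \<in> K \<Longrightarrow> ?f q \<le> ?f p"
    using continuous_attains_sup by metis
  have pM: "p \<in> F ` topspace M" using p by (simp add: K_def)
  have "?f p0 \<le> ?f p" by (rule max) (use p0 in \<open>simp add: K_def mem_Times_iff\<close>)
  then have fp: "?f p > 0" using pos[OF p0] by simp
  have "snd p \<noteq> T - pi" "snd p \<noteq> T + pi"
    using fp by (auto simp: barrier_def)
  then have pW: "p \<in> ?W" using p by (auto simp: K_def mem_Times_iff)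
  have W: "open ?W" by (intro open_Times) auto
  have le: "1 * ?f q \<le> 1 * ?f p" if "q \<in> F ` topspace M" "q \<in> ?W" for q
    using max[of q] that by (simp add: K_def mem_Times_iff)
  obtain v1 v2 where v: "H2xR_metric p v1 v1 = 1" "H2xR_metric p v2 v2 = 1" "H2xR_metric p v1 v2 = 0"
    "barrier_deriv 0 (1/2) T p v1 = 0" "barrier_deriv 0 (1/2) T p v2 = 0"
    "1 * (barrier_hess 0 (1/2) T p v1 + barrier_hess 0 (1/2) T p v2) \<le> 0"
    by (rule barrier_extremum_on_minimal_surface[OF imm min pM W pW le, simplified]) auto
  have "barrier_hess 0 (1/2) T p v1 + barrier_hess 0 (1/2) T p v2 > 0"
    by (rule barrier_trace_pos[OF _ v(1-5)]) (use pM H pW cos[of "snd p"] in \<open>auto simp: mem_Times_iff\<close>)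
  with v(6) show False by simp
qed

text \<open>
  A point above height \<open>b\<close> lies in an open slab of width \<open>2 \<pi>\<close> that stays above \<open>b\<close>, and
  such a slab contains no asymptotic boundary; similarly below \<open>a\<close>.
\<close>

lemma slab_confinement:
  assumes imm: "immersed_surface H2xR M \<A> F" and min: "minimal_immersion H2xR_metric \<A> F"
    and \<Sigma>: "closedin (top_of_set H2xR) (F ` topspace M)"
    and S: "asymptotic_boundary (F ` topspace M) \<subseteq> UNIV \<times> {a<..<b}"
  shows "F ` topspace M \<subseteq> UNIV \<times> {a..b}"
proof (rule ccontr)
  assume "\<not> ?thesis"
  then obtain p where p: "p \<in> F ` topspace M" "snd p < a \<or> snd p > b" by force
  define T where "T = (if snd p > b then max (snd p) (b + pi) else min (snd p) (a - pi))"
  have "asymptotic_boundary (F ` topspace M) \<inter> (UNIV \<times> {T - pi..T + pi}) = {}"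
    using S p(2) unfolding T_def by (fastforce split: if_splits)
  from empty_in_slab_free_of_asymptotic_boundary[OF imm min \<Sigma> this] p(1)
  have "p \<notin> UNIV \<times> {T - pi<..<T + pi}" by blast
  then show False using p(2) by (auto simp: mem_Times_iff T_def max_def min_def split: if_splits)
qed

text \<open>
  The barrier based at the omitted ideal point \<open>q\<close> is \<open>|z - q|\<^sup>2 / (1 - |z|\<^sup>2) * cos (l (t - T))\<close>. As the
  width is below \<open>\<pi>\<close>, there is some \<open>l > 1\<close> for which the cosine is still positive on the whole
  slab. The barrier then tends to infinity at every ideal point of the slab other than those over \<open>q\<close>,
  hence at the asymptotic boundary, so it has a minimum on the surface. This is impossible
  because the trace is negative.
\<close>

lemma no_minimal_surface_avoiding_ideal_point:
  assumes imm: "immersed_surface H2xR M \<A> F" and min: "minimal_immersion H2xR_metric \<A> F"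
    and \<Sigma>: "closedin (top_of_set H2xR) (F ` topspace M)"
    and slab: "F ` topspace M \<subseteq> UNIV \<times> {a..b}" and width: "b - a < pi"
    and q: "q \<in> bdry_H2" "\<And>t. (q, t) \<notin> asymptotic_boundary (F ` topspace M)"
  shows False
proof -
  have H: "F ` topspace M \<subseteq> H2xR" using imm by (simp add: immersed_surface_def)
  have ne: "F ` topspace M \<noteq> {}" using imm unfolding immersed_surface_def smooth_surface_def by blast
  then obtain p0 where p0: "p0 \<in> F ` topspace M" by blast
  have ab: "a \<le> b" using slab p0 by auto
  \<comment> \<open>The choice of \<open>l\<close> makes \<open>l > 1\<close> and \<open>l (b - a) < \<pi>\<close> both equivalent to \<open>b - a < \<pi>\<close>.\<close>
  define l T where "l = 2 * pi / (pi + (b - a))" and "T = (a + b) / 2"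
  have den: "pi + (b - a) > 0" using ab pi_gt_zero by linarith
  have l: "l > 1" using width den by (simp add: l_def field_simps)
  have "pi * (2 * (b - a)) < pi * (pi + (b - a))" using width by (intro mult_strict_left_mono) auto
  then have lw: "l * (b - a) < pi" using den by (simp add: l_def field_simps)
  have cos: "cos (l * (t - T)) > 0" if "t \<in> {a..b}" for t
  proof (rule cos_gt_zero_pi)
    have "l * (t - T) \<le> l * ((b - a) / 2)" "l * (a - b) / 2 \<le> l * (t - T)"
      using that l by (simp_all add: T_def field_simps)
    then show "- (pi / 2) < l * (t - T)" "l * (t - T) < pi / 2" using lw by (simp_all add: field_simps)
  qed
  let ?f = "barrier q l T"
  \<comment> \<open>On the surface \<open>C\<close> is a sublevel set; multiplying by \<open>1 - |z|\<^sup>2\<close> extends it to the ideal boundary.\<close>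
  define C where "C = (UNIV \<times> {a..b}) \<inter>
    {p. (norm (fst p - q))\<^sup>2 * cos (l * (snd p - T)) \<le> ?f p0 * (1 - fst p \<bullet> fst p)}"
  have C: "closed C" "C \<subseteq> UNIV \<times> {a..b}"
    unfolding C_def by (auto intro!: closed_Int closed_Times closed_Collect_le continuous_intros)
  have disj: "asymptotic_boundary (F ` topspace M) \<inter> C = {}"
  proof (rule ccontr)
    assume "\<not> ?thesis"
    then obtain p where p: "p \<in> asymptotic_boundary (F ` topspace M)" "p \<in> C" by auto
    then have "norm (fst p) = 1" by (auto simp: asymptotic_boundary_def bdry_H2_def)
    then have "(norm (fst p - q))\<^sup>2 * cos (l * (snd p - T)) \<le> 0"
      using p(2) by (simp add: C_def norm_eq_1)
    moreover have "cos (l * (snd p - T)) > 0" using p(2) by (intro cos) (auto simp: C_def)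
    ultimately have "fst p = q" by (simp add: mult_le_0_iff)
    then show False using q(2)[of "snd p"] p(1) by (cases p) auto
  qed
  have le_iff: "p \<in> C \<longleftrightarrow> ?f p \<le> ?f p0" if "p \<in> F ` topspace M" for p
  proof -
    have "1 - fst p \<bullet> fst p > 0" using that H by (auto simp: H2xR_def H2_inner)
    then show ?thesis
      using slab that unfolding C_def barrier_def hyp_form_ideal[OF q(1)] by (auto simp: field_simps)
  qed
  define K where "K = F ` topspace M \<inter> C"
  have "compact K" unfolding K_def by (rule compact_away_from_asymptotic_boundary[OF \<Sigma> C disj])
  moreover have "K \<noteq> {}" using p0 le_iff[OF p0] by (auto simp: K_def)
  moreover have "continuous_on K ?f"
    by (rule continuous_on_subset[OF continuous_on_barrier]) (use H in \<open>auto simp: K_def\<close>)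
  ultimately obtain p where p: "p \<in> K" and minK: "\<And>r. r \<in> K \<Longrightarrow> ?f p \<le> ?f r"
    using continuous_attains_inf by metis
  have pM: "p \<in> F ` topspace M" using p by (simp add: K_def)
  have le: "- 1 * ?f r \<le> - 1 * ?f p" if "r \<in> F ` topspace M" "r \<in> UNIV" for r
    using minK[of r] le_iff[of r] le_iff[OF pM] p that by (force simp: K_def)
  obtain v1 v2 where v: "H2xR_metric p v1 v1 = 1" "H2xR_metric p v2 v2 = 1" "H2xR_metric p v1 v2 = 0"
    "barrier_deriv q l T p v1 = 0" "barrier_deriv q l T p v2 = 0"
    "- 1 * (barrier_hess q l T p v1 + barrier_hess q l T p v2) \<le> 0"
    by (rule barrier_extremum_on_minimal_surface[OF imm min pM open_UNIV UNIV_I le]) auto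
  have "barrier_hess q l T p v1 + barrier_hess q l T p v2 < 0"
    by (rule barrier_trace_neg[OF _ v(1-5) _ l q(1)]) (use pM H slab cos in auto)
  with v(6) show False by simp
qed

theorem corollary2p2:
  fixes S :: "(complex \<times> real) set" and t1 t2 :: real
  assumes "closedin (top_of_set (bdry_H2 \<times> UNIV)) S"
    and "t2 - t1 = pi"
    and "S \<subseteq> bdry_H2 \<times> {t1<..<t2}"
    and "\<exists>J. open_arc J \<and> (J \<times> {0}) \<inter> vertical_projection ` S = {}"
  shows "\<not> (\<exists>(M :: 'a topology) \<A> F.
    complete_properly_immersed_minimal_surface M \<A> F \<and>
    asymptotic_boundary (F ` topspace M) = S)"
proof
  assume "\<exists>(M :: 'a topology) \<A> F.
    complete_properly_immersed_minimal_surface M \<A> F \<and> asymptotic_boundary (F ` topspace M) = S"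
  then obtain M :: "'a topology" and \<A> F where imm: "immersed_surface H2xR M \<A> F"
    and min: "minimal_immersion H2xR_metric \<A> F" and pr: "proper_map M (top_of_set H2xR) F"
    and S: "asymptotic_boundary (F ` topspace M) = S"
    by (auto simp: complete_properly_immersed_minimal_surface_def properly_immersed_def)
  have \<Sigma>: "closedin (top_of_set H2xR) (F ` topspace M)"
    using proper_imp_closed_map[OF pr] by (simp add: closed_map_def)
  have "closed (bdry_H2 \<times> (UNIV :: real set))" unfolding bdry_H2_def by (intro closed_Times) auto
  then have "closed S" using assms(1) closedin_closed_trans by blast
  moreover have "S \<subseteq> sphere 0 1 \<times> {t1..t2}" using assms(3) by (force simp: bdry_H2_def)
  then have "bounded S" by (rule bounded_subset[rotated]) (intro bounded_Times bounded_closed_interval bounded_sphere)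
  ultimately have "compact S" by (simp add: compact_eq_bounded_closed)
  then have "compact (snd ` S)" by (intro compact_continuous_image continuous_intros)
  obtain a b where ab: "t1 < a" "b < t2" "snd ` S \<subseteq> {a<..<b}"
  proof (cases "S = {}")
    case True
    then show ?thesis using that[of "t1 + 1" "t2 - 1"] by simp
  next
    case False
    obtain m where m: "m \<in> snd ` S" "\<forall>t \<in> snd ` S. m \<le> t"
      using compact_attains_inf[OF \<open>compact (snd ` S)\<close>] False by auto
    obtain n where n: "n \<in> snd ` S" "\<forall>t \<in> snd ` S. t \<le> n"
      using compact_attains_sup[OF \<open>compact (snd ` S)\<close>] False by auto
    have "t1 < m" "n < t2" using m(1) n(1) assms(3) by auto
    then have *: "t1 < (t1 + m) / 2" "(t1 + m) / 2 < m" "n < (n + t2) / 2" "(n + t2) / 2 < t2"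
      by auto
    show ?thesis by (rule that[OF *(1,4)]) (use * m n in force)
  qed
  have "F ` topspace M \<subseteq> UNIV \<times> {a..b}"
    by (rule slab_confinement[OF imm min \<Sigma>]) (use ab(3) S in force)
  moreover have "b - a < pi" using ab assms(2) by linarith
  moreover obtain q where q: "q \<in> bdry_H2" "\<And>t. (q, t) \<notin> S"
  proof -
    obtain \<theta>1 \<theta>2 where J: "\<theta>1 < \<theta>2" "(cis ` {\<theta>1<..<\<theta>2} \<times> {0}) \<inter> vertical_projection ` S = {}"
      using assms(4) unfolding open_arc_def by blast
    let ?q = "cis ((\<theta>1 + \<theta>2) / 2)"
    have "(?q, t) \<notin> S" for t
    proof
      assume "(?q, t) \<in> S"
      then have "(?q, 0) \<in> vertical_projection ` S" by (force simp: vertical_projection_def)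
      moreover have "?q \<in> cis ` {\<theta>1<..<\<theta>2}" using J(1) by auto
      ultimately show False using J(2) by auto
    qed
    then show ?thesis using that[of ?q] by (simp add: bdry_H2_def)
  qed
  ultimately show False
    using no_minimal_surface_avoiding_ideal_point[OF imm min \<Sigma>] S by blast
qed

end
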